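(* Let $T$ be a theory in a countable relational vocabulary $\tau$ and $n\geq 2$. The following are equivalent: (1) $T$ has a $\forall_n$-axiomatization but no $\forall_{n-1}$-axiomatization; (2) the Wadge degree of $\mathrm{Mod}(T)$ lies in the interval $[\boldsymbol\Sigma^0_{n-1},\boldsymbol\Pi^0_n]$, i.e., $\mathrm{Mod}(T)\in\boldsymbol\Pi^0_n$ and $\mathrm{Mod}(T)$ is $\boldsymbol\Sigma^0_{n-1}$-hard.
   Context: $\mathrm{Mod}(\tau)\subseteq 2^\omega$ is the Polish space of atomic diagrams of $\tau$-structures with universe $\omega$; $\mathrm{Mod}(T)$ is the subset of models of $T$. $T$ has a $\forall_n$-axiomatization if some set of $\forall_n$-sentences (prenex, $n$ alternating quantifier blocks starting with $\forall$) has the same deductive closure as $T$. A set is $\Gamma$-hard if every $\Gamma$ subset of $2^\omega$ continuously (Wadge) reduces to it. Complete theories considered are assumed to have infinite models.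
   Formalization: "Axiomatization" here means having the same models with universe ω as T, not the same deductive closure; with literal deductive closure the claim fails for n=2, e.g. for the theory of infinite sets, which has no ∀_1-axiomatization although Mod(T) is the whole space. *)

theory Defs
  imports "HOL-Analysis.Analysis"
begin

type_synonym vocab = "nat set \<times> (nat \<Rightarrow> nat)"

definition syms :: "vocab \<Rightarrow> nat set" where "syms \<tau> = fst \<tau>"
definition arity :: "vocab \<Rightarrow> nat \<Rightarrow> nat" where "arity \<tau> = snd \<tau>"

datatype fm =
    Eq nat nat
  | Rel nat "nat list"
  | Neg fm
  | Conj fm fm
  | Disj fm fm
  | Imp fm fm
  | Ex nat fm
  | All nat fm

fun wf_fm :: "vocab \<Rightarrow> fm \<Rightarrow> bool" where
  "wf_fm \<tau> (Eq x y) = True"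
| "wf_fm \<tau> (Rel R xs) = (R \<in> syms \<tau> \<and> length xs = arity \<tau> R)"
| "wf_fm \<tau> (Neg p) = wf_fm \<tau> p"
| "wf_fm \<tau> (Conj p q) = (wf_fm \<tau> p \<and> wf_fm \<tau> q)"
| "wf_fm \<tau> (Disj p q) = (wf_fm \<tau> p \<and> wf_fm \<tau> q)"
| "wf_fm \<tau> (Imp p q) = (wf_fm \<tau> p \<and> wf_fm \<tau> q)"
| "wf_fm \<tau> (Ex x p) = wf_fm \<tau> p"
| "wf_fm \<tau> (All x p) = wf_fm \<tau> p"

fun fv :: "fm \<Rightarrow> nat set" where
  "fv (Eq x y) = {x, y}"
| "fv (Rel R xs) = set xs"
| "fv (Neg p) = fv p"
| "fv (Conj p q) = fv p \<union> fv q"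
| "fv (Disj p q) = fv p \<union> fv q"
| "fv (Imp p q) = fv p \<union> fv q"
| "fv (Ex x p) = fv p - {x}"
| "fv (All x p) = fv p - {x}"

definition sentence :: "vocab \<Rightarrow> fm \<Rightarrow> bool" where
  "sentence \<tau> p \<longleftrightarrow> wf_fm \<tau> p \<and> fv p = {}"

fun qfree :: "fm \<Rightarrow> bool" where
  "qfree (Eq x y) = True"
| "qfree (Rel R xs) = True"
| "qfree (Neg p) = qfree p"
| "qfree (Conj p q) = (qfree p \<and> qfree q)"
| "qfree (Disj p q) = (qfree p \<and> qfree q)"
| "qfree (Imp p q) = (qfree p \<and> qfree q)"
| "qfree (Ex x p) = False"
| "qfree (All x p) = False"

text \<open>Prenex classes: univ_n n = \<forall>_n (n alternating blocks, starting with \<forall>,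
  blocks possibly empty), exi_n n = \<exists>_n.\<close>
inductive univ_n :: "nat \<Rightarrow> fm \<Rightarrow> bool" and exi_n :: "nat \<Rightarrow> fm \<Rightarrow> bool" where
  "qfree p \<Longrightarrow> univ_n 0 p"
| "exi_n n p \<Longrightarrow> univ_n (Suc n) p"
| "univ_n (Suc n) p \<Longrightarrow> univ_n (Suc n) (All x p)"
| "qfree p \<Longrightarrow> exi_n 0 p"
| "univ_n n p \<Longrightarrow> exi_n (Suc n) p"
| "exi_n (Suc n) p \<Longrightarrow> exi_n (Suc n) (Ex x p)"

definition atoms :: "vocab \<Rightarrow> (nat \<times> nat list) set" where
  "atoms \<tau> = {(R, as). R \<in> syms \<tau> \<and> length as = arity \<tau> R}"

definition ModSpace :: "vocab \<Rightarrow> (nat \<times> nat list \<Rightarrow> bool) topology" where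
  "ModSpace \<tau> = product_topology (\<lambda>_. discrete_topology (UNIV :: bool set)) (atoms \<tau>)"

definition Cantor :: "(nat \<Rightarrow> bool) topology" where
  "Cantor = product_topology (\<lambda>_. discrete_topology (UNIV :: bool set)) (UNIV :: nat set)"

fun sat :: "(nat \<times> nat list \<Rightarrow> bool) \<Rightarrow> (nat \<Rightarrow> nat) \<Rightarrow> fm \<Rightarrow> bool" where
  "sat M e (Eq x y) = (e x = e y)"
| "sat M e (Rel R xs) = M (R, map e xs)"
| "sat M e (Neg p) = (\<not> sat M e p)"
| "sat M e (Conj p q) = (sat M e p \<and> sat M e q)"
| "sat M e (Disj p q) = (sat M e p \<or> sat M e q)"
| "sat M e (Imp p q) = (sat M e p \<longrightarrow> sat M e q)"
| "sat M e (Ex x p) = (\<exists>a. sat M (e(x := a)) p)"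
| "sat M e (All x p) = (\<forall>a. sat M (e(x := a)) p)"

definition Mod :: "vocab \<Rightarrow> fm set \<Rightarrow> (nat \<times> nat list \<Rightarrow> bool) set" where
  "Mod \<tau> T = {M \<in> topspace (ModSpace \<tau>). \<forall>p\<in>T. \<forall>e. sat M e p}"

definition has_univ_axiomatization :: "vocab \<Rightarrow> fm set \<Rightarrow> nat \<Rightarrow> bool" where
  "has_univ_axiomatization \<tau> T n \<longleftrightarrow>
     (\<exists>S. (\<forall>p\<in>S. sentence \<tau> p \<and> univ_n n p) \<and> Mod \<tau> S = Mod \<tau> T)"

fun bSigma :: "'a topology \<Rightarrow> nat \<Rightarrow> 'a set set" where
  "bSigma X 0 = {}"
| "bSigma X (Suc 0) = {A. openin X A}"
| "bSigma X (Suc (Suc n)) =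
     {\<Union>(range B) | B :: nat \<Rightarrow> 'a set. \<forall>i. B i \<subseteq> topspace X \<and> topspace X - B i \<in> bSigma X (Suc n)}"

definition bPi :: "'a topology \<Rightarrow> nat \<Rightarrow> 'a set set" where
  "bPi X n = {A. A \<subseteq> topspace X \<and> topspace X - A \<in> bSigma X n}"

definition hard :: "(nat \<Rightarrow> bool) set set \<Rightarrow> 'b topology \<Rightarrow> 'b set \<Rightarrow> bool" where
  "hard \<Gamma> Y B \<longleftrightarrow> (\<forall>A\<in>\<Gamma>. \<exists>f. continuous_map Cantor Y f \<and>
                        (\<forall>x\<in>topspace Cantor. x \<in> A \<longleftrightarrow> f x \<in> B))"

end

theory Submission
  imports Defs
begin

text \<open>
  The heart of the matter is that a theory \<open>T\<close> without a \<open>\<forall>\<^sub>m\<close>-axiomatization has a \<open>\<Sigma>\<^sub>m\<close>-hard set of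
  models. Since \<open>\<forall>\<^sub>m\<close>-axiomatizable theories have a \<open>\<Pi>\<^sub>m\<close> set of models and a \<open>\<Sigma>\<^sub>m\<close>-hard set is not \<open>\<Pi>\<^sub>m\<close>,
  it follows for every \<open>m \<ge> 1\<close> that \<open>\<forall>\<^sub>m\<close>-axiomatizability of \<open>T\<close>, \<open>Mod T \<in> \<Pi>\<^sub>m\<close> and the failure of
  \<open>\<Sigma>\<^sub>m\<close>-hardness are equivalent, and the theorem combines this for \<open>m = n\<close> and \<open>m = n - 1\<close>.

  For the hardness, take \<open>M\<close> not a model of \<open>T\<close> that satisfies all \<open>\<forall>\<^sub>m\<close>-consequences of \<open>T\<close>, and models
  \<open>N\<^sub>i\<close> of \<open>T\<close> refuting the first \<open>i\<close> of the \<open>\<forall>\<^sub>m\<close>-sentences that fail in \<open>M\<close>. Passing to ultraproducts and then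
  to countable substructures closed under realising the types involved, one gets countable \<open>M\<close> and \<open>N \<Turnstile> T\<close>
  for which inclusion of \<open>\<forall>\<^sub>k\<close>-types has the back-and-forth property of the infinitary relations \<open>\<le>\<^sub>k\<close>, and every
  \<open>\<forall>\<^sub>m\<close>-sentence true in \<open>N\<close> holds in \<open>M\<close>. Given a \<open>\<Sigma>\<^sub>m\<close> set \<open>A\<close>, a structure is then built from
  finite initial segments of \<open>x\<close>: at each stage a finite tuple of \<open>M\<close> or \<open>N\<close> is chosen, according to whether \<open>x \<in> A\<close>
  is currently believed, so that its \<open>\<forall>\<^sub>k\<close>-type grows along stages that look true at level \<open>k\<close> (Ash's
  metatheorem, in the true-stage form of Montalban). The limit is isomorphic to \<open>N\<close> if \<open>x \<in> A\<close> and to \<open>M\<close> otherwise.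
\<close>

subsection \<open>Prenex formulas\<close>

text \<open>Countability turns an axiom set into a countable intersection, lets sets of formulas be
  enumerated, and keeps the number of closure conditions in the later Skolem hull countable.\<close>

instance fm :: countable
  by countable_datatype

lemma finite_fv: "finite (fv p)"
  by (induction p) auto

lemma sat_cong: "(\<And>v. v \<in> fv p \<Longrightarrow> e v = e' v) \<Longrightarrow> sat M e p = sat M e' p"
proof (induction p arbitrary: e e')
  case (Rel R xs)
  then have "map e xs = map e' xs" by simp
  then show ?case by (simp only: sat.simps)
next
  case (Conj p q)
  have "sat M e p = sat M e' p" "sat M e q = sat M e' q"
    using Conj.prems by (auto intro!: Conj.IH)
  then show ?case by simp
next
  case (Disj p q)
  have "sat M e p = sat M e' p" "sat M e q = sat M e' q"
    using Disj.prems by (auto intro!: Disj.IH)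
  then show ?case by simp
next
  case (Imp p q)
  have "sat M e p = sat M e' p" "sat M e q = sat M e' q"
    using Imp.prems by (auto intro!: Imp.IH)
  then show ?case by simp
next
  case (Ex x p)
  have "sat M (e(x := a)) p = sat M (e'(x := a)) p" for a
    by (rule Ex.IH) (use Ex.prems in auto)
  then show ?case by simp
next
  case (All x p)
  have "sat M (e(x := a)) p = sat M (e'(x := a)) p" for a
    by (rule All.IH) (use All.prems in auto)
  then show ?case by simp
next
  case (Neg p)
  have "sat M e p = sat M e' p"
    using Neg.prems by (auto intro!: Neg.IH)
  then show ?case by simp
qed simp

lemma sat_upd_notin: "x \<notin> fv p \<Longrightarrow> sat M (e(x := a)) p = sat M e p"
  by (rule sat_cong) auto

lemma sat_sentence: "fv p = {} \<Longrightarrow> sat M e p = sat M e' p"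
  by (rule sat_cong) auto

lemma univ_exi_Suc:
  "univ_n n p \<Longrightarrow> univ_n (Suc n) p" "exi_n n p \<Longrightarrow> exi_n (Suc n) p"
  by (induction rule: univ_n_exi_n.inducts) (auto intro: univ_n_exi_n.intros)

lemma univ_n_0_iff: "univ_n 0 p \<longleftrightarrow> qfree p"
  by (auto elim: univ_n.cases intro: univ_n_exi_n.intros)

lemma exi_n_0_iff: "exi_n 0 p \<longleftrightarrow> qfree p"
  by (auto elim: exi_n.cases intro: univ_n_exi_n.intros)

lemma qfree_univ_n: "qfree p \<Longrightarrow> univ_n n p"
  by (induction n) (auto intro: univ_n_exi_n.intros univ_exi_Suc)

lemma univ_n_mono: "univ_n m p \<Longrightarrow> m \<le> n \<Longrightarrow> univ_n n p"
  by (induction n) (auto simp: le_Suc_eq intro: univ_exi_Suc)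

section \<open>Renaming of bound variables\<close>

fun rename :: "(nat \<Rightarrow> nat) \<Rightarrow> fm \<Rightarrow> fm" where
  "rename s (Eq x y) = Eq (s x) (s y)"
| "rename s (Rel R xs) = Rel R (map s xs)"
| "rename s (Neg p) = Neg (rename s p)"
| "rename s (Conj p q) = Conj (rename s p) (rename s q)"
| "rename s (Disj p q) = Disj (rename s p) (rename s q)"
| "rename s (Imp p q) = Imp (rename s p) (rename s q)"
| "rename s (Ex x p) = Ex (s x) (rename s p)"
| "rename s (All x p) = All (s x) (rename s p)"

text \<open>Bound variables are renamed together with free ones, so injectivity of \<open>s\<close>
  rules out capture.\<close>

lemma sat_rename: "inj s \<Longrightarrow> sat M e (rename s p) = sat M (e \<circ> s) p"
proof (induction p arbitrary: e)
  case (Ex x p)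
  have "e(s x := a) \<circ> s = (e \<circ> s)(x := a)" for a
    using Ex.prems by (auto simp: fun_eq_iff inj_eq)
  with Ex show ?case by (simp only: rename.simps sat.simps)
next
  case (All x p)
  have "e(s x := a) \<circ> s = (e \<circ> s)(x := a)" for a
    using All.prems by (auto simp: fun_eq_iff inj_eq)
  with All show ?case by (simp only: rename.simps sat.simps)
qed auto

lemma fv_rename: "inj s \<Longrightarrow> fv (rename s p) = s ` fv p"
  by (induction p) (auto simp: inj_eq image_Un)

lemma wf_rename: "wf_fm \<tau> (rename s p) = wf_fm \<tau> p"
  by (induction p) auto

lemma qfree_rename: "qfree (rename s p) = qfree p"
  by (induction p) auto

lemma size_rename: "size (rename s p) = size p"
  by (induction p) auto

lemma univ_exi_rename:
  "univ_n n p \<Longrightarrow> univ_n n (rename s p)" "exi_n n p \<Longrightarrow> exi_n n (rename s p)"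
  by (induction rule: univ_n_exi_n.inducts) (auto intro: univ_n_exi_n.intros simp: qfree_rename)

text \<open>A transposition is injective, and with \<open>z\<close> fresh the only free variable of
  \<open>p\<close> that it can move is \<open>x\<close>.\<close>

lemma rename_bound:
  assumes "z \<notin> fv p"
  shows "sat M (e(z := a)) (rename (Transposition.transpose x z) p) = sat M (e(x := a)) p"
    and "fv (rename (Transposition.transpose x z) p) - {z} = fv p - {x}"
proof -
  have inj: "inj (Transposition.transpose x z)" by (rule inj_transpose)
  show "sat M (e(z := a)) (rename (Transposition.transpose x z) p) = sat M (e(x := a)) p"
    unfolding sat_rename[OF inj]
    by (rule sat_cong) (use assms(1) in \<open>auto simp: Transposition.transpose_def\<close>)
  show "fv (rename (Transposition.transpose x z) p) - {z} = fv p - {x}"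
    unfolding fv_rename[OF inj]
    using assms(1) by (auto simp: Transposition.transpose_def image_iff)
qed

section \<open>Closure of the prenex classes under Boolean operations\<close>

lemma prenex_neg:
  "univ_n n p \<Longrightarrow> \<exists>q. exi_n n q \<and> (\<forall>M e. sat M e q = (\<not> sat M e p)) \<and> fv q = fv p \<and> wf_fm \<tau> q = wf_fm \<tau> p"
  "exi_n n p \<Longrightarrow> \<exists>q. univ_n n q \<and> (\<forall>M e. sat M e q = (\<not> sat M e p)) \<and> fv q = fv p \<and> wf_fm \<tau> q = wf_fm \<tau> p"
proof (induction rule: univ_n_exi_n.inducts)
  case (1 p)
  then show ?case by (intro exI[of _ "Neg p"]) (auto simp: exi_n_0_iff)
next
  case (3 n p x)
  then obtain q where "exi_n (Suc n) q" "\<forall>M e. sat M e q = (\<not> sat M e p)" "fv q = fv p" "wf_fm \<tau> q = wf_fm \<tau> p"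
    by blast
  then show ?case by (intro exI[of _ "Ex x q"]) (simp add: univ_n_exi_n.intros)
next
  case (4 p)
  then show ?case by (intro exI[of _ "Neg p"]) (auto simp: univ_n_0_iff)
next
  case (6 n p x)
  then obtain q where "univ_n (Suc n) q" "\<forall>M e. sat M e q = (\<not> sat M e p)" "fv q = fv p" "wf_fm \<tau> q = wf_fm \<tau> p"
    by blast
  then show ?case by (intro exI[of _ "All x q"]) (simp add: univ_n_exi_n.intros)
next
  case (2 n p)
  then show ?case using univ_n_exi_n.intros(5) by blast
next
  case (5 n p)
  then show ?case using univ_n_exi_n.intros(2) by blast
qed

text \<open>One symbol for both connectives, because negation exchanges them by flipping
  \<open>b\<close>.\<close>

definition junct :: "bool \<Rightarrow> fm \<Rightarrow> fm \<Rightarrow> fm" where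
  "junct b p q = (if b then Conj p q else Disj p q)"

definition prenex_junct :: "vocab \<Rightarrow> (fm \<Rightarrow> bool) \<Rightarrow> bool \<Rightarrow> fm \<Rightarrow> fm \<Rightarrow> bool" where
  "prenex_junct \<tau> P b p q \<longleftrightarrow> (\<exists>r. P r \<and> (\<forall>M e. sat M e r = sat M e (junct b p q)) \<and>
     fv r \<subseteq> fv p \<union> fv q \<and> (wf_fm \<tau> p \<longrightarrow> wf_fm \<tau> q \<longrightarrow> wf_fm \<tau> r))"

lemma prenex_junct_mono: "(\<And>r. P r \<Longrightarrow> Q r) \<Longrightarrow> prenex_junct \<tau> P b p q \<Longrightarrow> prenex_junct \<tau> Q b p q"
  unfolding prenex_junct_def by blast

lemma prenex_junct_commute: "prenex_junct \<tau> P b p q \<longleftrightarrow> prenex_junct \<tau> P b q p"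
proof -
  have "sat M e (junct b p q) = sat M e (junct b q p)" for M e p q
    by (auto simp: junct_def)
  then have "prenex_junct \<tau> P b q p" if "prenex_junct \<tau> P b p q" for p q
    using that unfolding prenex_junct_def by (metis Un_commute)
  then show ?thesis by blast
qed

text \<open>The quantifier moves out once its variable is fresh for both formulas. The hypothesis
  covers all bodies of the same size because the body is renamed on the way.\<close>

lemma prenex_junct_All:
  assumes "\<And>p'. univ_n (Suc n) p' \<Longrightarrow> size p' = size p \<Longrightarrow> prenex_junct \<tau> (univ_n (Suc n)) b p' q"
    and "univ_n (Suc n) p"
  shows "prenex_junct \<tau> (univ_n (Suc n)) b (All x p) q"
proof -
  obtain z where z: "z \<notin> fv p \<union> fv q"
    using ex_new_if_finite[OF infinite_UNIV_nat] finite_fv finite_UnI by metis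
  define p' where "p' = rename (Transposition.transpose x z) p"
  have "prenex_junct \<tau> (univ_n (Suc n)) b p' q"
    using assms univ_exi_rename(1) size_rename unfolding p'_def by blast
  then obtain r where r: "univ_n (Suc n) r" "\<And>M e. sat M e r = sat M e (junct b p' q)"
      "fv r \<subseteq> fv p' \<union> fv q" "wf_fm \<tau> p' \<Longrightarrow> wf_fm \<tau> q \<Longrightarrow> wf_fm \<tau> r"
    unfolding prenex_junct_def by blast
  have p': "sat M (e(z := a)) p' = sat M (e(x := a)) p" "fv p' - {z} = fv p - {x}" for M e a
    unfolding p'_def using rename_bound z by blast+
  have q: "sat M (e(z := a)) q = sat M e q" for M e a
    using z sat_upd_notin by blast
  have "sat M e (All z r) = sat M e (junct b (All x p) q)" for M e
    by (auto simp: r(2) junct_def p' q)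
  moreover have "fv (All z r) \<subseteq> fv (All x p) \<union> fv q"
    using r(3) p'(2) by auto
  ultimately show ?thesis
    unfolding prenex_junct_def using r(1,4)
    by (intro exI[of _ "All z r"]) (auto intro: univ_n_exi_n.intros simp: p'_def wf_rename)
qed

text \<open>De Morgan: negate both formulas, form the opposite junction among universal formulas,
  and negate again.\<close>

lemma prenex_junct_exi:
  assumes "\<And>b p q. univ_n n p \<Longrightarrow> univ_n n q \<Longrightarrow> prenex_junct \<tau> (univ_n n) b p q"
    and "exi_n n p" "exi_n n q"
  shows "prenex_junct \<tau> (exi_n n) b p q"
proof -
  obtain p' where p': "univ_n n p'" "\<And>M e. sat M e p' = (\<not> sat M e p)" "fv p' = fv p" "wf_fm \<tau> p' = wf_fm \<tau> p"
    using prenex_neg(2)[OF assms(2), of \<tau>] by blast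
  obtain q' where q': "univ_n n q'" "\<And>M e. sat M e q' = (\<not> sat M e q)" "fv q' = fv q" "wf_fm \<tau> q' = wf_fm \<tau> q"
    using prenex_neg(2)[OF assms(3), of \<tau>] by blast
  obtain r where r: "univ_n n r" "\<And>M e. sat M e r = sat M e (junct (\<not> b) p' q')"
      "fv r \<subseteq> fv p' \<union> fv q'" "wf_fm \<tau> p' \<longrightarrow> wf_fm \<tau> q' \<longrightarrow> wf_fm \<tau> r"
    using assms(1)[OF p'(1) q'(1)] unfolding prenex_junct_def by blast
  obtain s where s: "exi_n n s" "\<And>M e. sat M e s = (\<not> sat M e r)" "fv s = fv r" "wf_fm \<tau> s = wf_fm \<tau> r"
    using prenex_neg(1)[OF r(1), of \<tau>] by blast
  show ?thesis
    unfolding prenex_junct_def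
    by (rule exI[of _ s]) (use r s p' q' in \<open>auto simp: junct_def\<close>)
qed

lemma prenex_junct_univ:
  "univ_n n p \<Longrightarrow> univ_n n q \<Longrightarrow> prenex_junct \<tau> (univ_n n) b p q"
proof (induction n arbitrary: b p q)
  case 0
  then show ?case
    unfolding prenex_junct_def by (intro exI[of _ "junct b p q"]) (auto simp: junct_def univ_n_0_iff)
next
  case (Suc n)
  show ?case
    using Suc.prems
  \<comment> \<open>The induction is on size since a renamed body is not a subformula. If neither
    formula is split at a leading universal quantifier, both lie in \<open>exi_n n\<close> and the
    induction on \<open>n\<close> applies.\<close>
  proof (induction "size p + size q" arbitrary: p q rule: less_induct)
    case less
    note IH = less.hyps
    consider x p' where "p = All x p'" "univ_n (Suc n) p'" | y q' where "q = All y q'" "univ_n (Suc n) q'"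
      | "exi_n n p" "exi_n n q"
      using less.prems(1)
    proof cases
      case 2
      note p = this
      show ?thesis
        using less.prems(2) by cases (use p that in auto)
    qed (use that in auto)
    then show ?case
    proof cases
      case 1
      show ?thesis
        unfolding 1(1)
      proof (rule prenex_junct_All[OF _ 1(2)])
        show "prenex_junct \<tau> (univ_n (Suc n)) b r q" if "univ_n (Suc n) r" "size r = size p'" for r
          using that 1 less.prems by (intro IH) auto
      qed
    next
      case 2
      have "prenex_junct \<tau> (univ_n (Suc n)) b (All y q') p"
      proof (rule prenex_junct_All[OF _ 2(2)])
        show "prenex_junct \<tau> (univ_n (Suc n)) b r p" if "univ_n (Suc n) r" "size r = size q'" for r
          using that 2 less.prems by (intro IH) auto
      qed
      then show ?thesis
        unfolding 2(1) by (subst prenex_junct_commute)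
    next
      case 3
      then have "prenex_junct \<tau> (exi_n n) b p q"
        using prenex_junct_exi Suc.IH by blast
      then show ?thesis
        by (rule prenex_junct_mono[rotated]) (rule univ_n_exi_n.intros)
    qed
  qed
qed

lemma prenex_junct_list:
  assumes "\<forall>p\<in>set ps. univ_n n p \<and> wf_fm \<tau> p \<and> fv p \<subseteq> V" "ps \<noteq> []"
  shows "\<exists>r. univ_n n r \<and> wf_fm \<tau> r \<and> fv r \<subseteq> V \<and>
    (\<forall>M e. sat M e r = (if b then \<forall>p\<in>set ps. sat M e p else \<exists>p\<in>set ps. sat M e p))"
  using assms(2,1)
proof (induction ps rule: list_nonempty_induct)
  case (single p)
  then show ?case by auto
next
  case (cons p ps)
  then obtain r where r: "univ_n n r" "wf_fm \<tau> r" "fv r \<subseteq> V"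
      "\<forall>M e. sat M e r = (if b then \<forall>p\<in>set ps. sat M e p else \<exists>p\<in>set ps. sat M e p)"
    by auto
  have p: "univ_n n p" "wf_fm \<tau> p" "fv p \<subseteq> V"
    using cons.prems by auto
  obtain r' where r': "univ_n n r'" "\<forall>M e. sat M e r' = sat M e (junct b p r)"
     "fv r' \<subseteq> fv p \<union> fv r" "wf_fm \<tau> p \<longrightarrow> wf_fm \<tau> r \<longrightarrow> wf_fm \<tau> r'"
    using prenex_junct_univ[OF p(1) r(1)] unfolding prenex_junct_def by blast
  have "sat M e r' = (if b then \<forall>p\<in>set (p # ps). sat M e p else \<exists>p\<in>set (p # ps). sat M e p)" for M e
    by (simp add: r'(2) r(4) junct_def)
  moreover have "fv r' \<subseteq> V" "wf_fm \<tau> r'"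
    using r' r p by auto
  ultimately show ?case
    using r'(1) by blast
qed

subsection \<open>Finite levels of the Borel hierarchy\<close>

lemma bSigma_subset: "A \<in> bSigma X n \<Longrightarrow> A \<subseteq> topspace X"
  by (induction X n rule: bSigma.induct) (auto dest: openin_subset)

lemma bPi_Suc_imp_bSigma: "A \<in> bPi X (Suc n) \<Longrightarrow> A \<in> bSigma X (Suc (Suc n))"
  unfolding bPi_def by (auto intro!: exI[of _ "\<lambda>_. A"])

lemma bSigma_UN:
  assumes "\<And>i::nat. A i \<in> bSigma X (Suc n)"
  shows "(\<Union>i. A i) \<in> bSigma X (Suc n)"
proof (cases n)
  case 0
  then show ?thesis using assms by auto
next
  case (Suc m)
  have "\<forall>i. \<exists>B. A i = \<Union>(range B) \<and> (\<forall>j::nat. B j \<subseteq> topspace X \<and> topspace X - B j \<in> bSigma X (Suc m))"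
    using assms Suc by auto
  then obtain B where B: "\<And>i. A i = (\<Union>j. B i j)"
      "\<And>i j::nat. B i j \<subseteq> topspace X \<and> topspace X - B i j \<in> bSigma X (Suc m)"
    by metis
  define C where "C = (\<lambda>k. B (fst (prod_decode k)) (snd (prod_decode k)))"
  have "(\<Union>i. A i) = \<Union>(range C)"
  proof (intro equalityI subsetI)
    fix x assume "x \<in> (\<Union>i. A i)"
    then obtain i j where "x \<in> B i j" using B by auto
    then have "x \<in> C (prod_encode (i, j))" by (simp add: C_def)
    then show "x \<in> \<Union>(range C)" by blast
  qed (auto simp: B(1) C_def)
  moreover have "\<forall>k. C k \<subseteq> topspace X \<and> topspace X - C k \<in> bSigma X (Suc m)"
    using B(2) by (auto simp: C_def)
  ultimately show ?thesis
    using Suc by auto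
qed

lemma bPi_INT:
  assumes "countable I" "\<And>i. i \<in> I \<Longrightarrow> {x \<in> topspace X. P i x} \<in> bPi X (Suc n)"
  shows "{x \<in> topspace X. \<forall>i\<in>I. P i x} \<in> bPi X (Suc n)"
proof -
  \<comment> \<open>For empty \<open>I\<close> the intersection is the whole space, whose complement
    is empty. The empty set and the whole space witness each other from one level to the
    next.\<close>
  have empty: "{} \<in> bSigma X (Suc n)" for n
  proof (induction n)
    case (Suc n)
    have "topspace X \<in> bSigma X (Suc k)" for k
    proof (induction k rule: less_induct)
      case (less k)
      show ?case
      proof (cases k)
        case (Suc j)
        have "{} \<in> bSigma X (Suc j)"
        proof (cases j)
          case (Suc l)
          then show ?thesis
            using less[of l] \<open>k = Suc j\<close> by (auto intro!: exI[of _ "\<lambda>_. {}"])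
        qed auto
        then show ?thesis
          using Suc by (auto intro!: exI[of _ "\<lambda>_. topspace X"])
      qed auto
    qed
    then show ?case by (auto intro!: exI[of _ "\<lambda>_. {}"])
  qed auto
  have eq: "topspace X - {x \<in> topspace X. \<forall>i\<in>I. P i x} = (\<Union>i\<in>I. topspace X - {x \<in> topspace X. P i x})"
    by auto
  show ?thesis
  proof (cases "I = {}")
    case True
    then show ?thesis using empty by (simp add: bPi_def)
  next
    case False
    have "(\<Union>i\<in>range (from_nat_into I). topspace X - {x \<in> topspace X. P i x}) =
        (\<Union>j. topspace X - {x \<in> topspace X. P (from_nat_into I j) x})"
      by blast
    then have "(\<Union>i\<in>I. topspace X - {x \<in> topspace X. P i x}) =
        (\<Union>j. topspace X - {x \<in> topspace X. P (from_nat_into I j) x})"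
      by (simp only: range_from_nat_into[OF False assms(1)])
    also have "\<dots> \<in> bSigma X (Suc n)"
      using assms(2) from_nat_into[OF False] unfolding bPi_def by (intro bSigma_UN) blast
    finally show ?thesis
      by (simp only: bPi_def eq mem_Collect_eq) blast
  qed
qed

lemma bSigma_vimage:
  assumes f: "continuous_map X Y f"
  shows "A \<in> bSigma Y n \<Longrightarrow> {x \<in> topspace X. f x \<in> A} \<in> bSigma X n"
proof (induction n arbitrary: A rule: less_induct)
  case (less n)
  consider "n = 0" | "n = 1" | k where "n = Suc (Suc k)"
    by (metis One_nat_def not0_implies_Suc)
  then show ?case
  proof cases
    case 2
    then show ?thesis using f less.prems by (simp add: openin_continuous_map_preimage)
  next
    case 3
    then obtain B :: "nat \<Rightarrow> _" where B: "A = \<Union>(range B)"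
        "\<And>i. B i \<subseteq> topspace Y \<and> topspace Y - B i \<in> bSigma Y (Suc k)"
      using less.prems by auto
    define C where "C i = {x \<in> topspace X. f x \<in> B i}" for i
    have "topspace X - C i = {x \<in> topspace X. f x \<in> topspace Y - B i}" for i
      using f unfolding C_def continuous_map_def by auto
    then have "topspace X - C i \<in> bSigma X (Suc k)" for i
      using less.IH[of "Suc k"] B(2) 3 by (simp only: lessI)
    moreover have "{x \<in> topspace X. f x \<in> A} = \<Union>(range C)"
      by (auto simp: B(1) C_def)
    ultimately show ?thesis
      using 3 C_def by auto
  qed (use less.prems in auto)
qed

section \<open>Cantor space and continuity in terms of finite prefixes\<close>

lemma topspace_Cantor: "topspace Cantor = UNIV"
  by (simp add: Cantor_def)

lemma topspace_ModSpace: "topspace (ModSpace \<tau>) = PiE (atoms \<tau>) (\<lambda>_. UNIV)"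
  by (simp add: ModSpace_def)

text \<open>A basic box restricts finitely many coordinates, so a prefix reaching beyond all of them
  stays inside it.\<close>

lemma openin_Cantor:
  "openin Cantor A \<longleftrightarrow> (\<forall>x\<in>A. \<exists>s. \<forall>y. (\<forall>i<s. y i = x i) \<longrightarrow> y \<in> A)"
proof
  assume A: "openin Cantor A"
  show "\<forall>x\<in>A. \<exists>s. \<forall>y. (\<forall>i<s. y i = x i) \<longrightarrow> y \<in> A"
  proof
    fix x assume "x \<in> A"
    then obtain U where U: "finite {i. U i \<noteq> UNIV}" "x \<in> PiE UNIV U" "PiE UNIV U \<subseteq> A"
      using A unfolding Cantor_def openin_product_topology_alt by force
    obtain s where s: "\<And>i. U i \<noteq> UNIV \<Longrightarrow> i < s"
      using U(1) unfolding finite_nat_set_iff_bounded by blast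
    have "y \<in> A" if y: "\<forall>i<s. y i = x i" for y
    proof -
      have "y i \<in> U i" for i
        using U(2) y s by (cases "U i = UNIV") (auto simp: PiE_iff)
      then show ?thesis using U(3) by auto
    qed
    then show "\<exists>s. \<forall>y. (\<forall>i<s. y i = x i) \<longrightarrow> y \<in> A" by blast
  qed
next
  assume A: "\<forall>x\<in>A. \<exists>s. \<forall>y. (\<forall>i<s. y i = x i) \<longrightarrow> y \<in> A"
  show "openin Cantor A"
    unfolding Cantor_def openin_product_topology_alt
  proof
    fix x assume "x \<in> A"
    then obtain s where s: "\<And>y. (\<forall>i<s. y i = x i) \<Longrightarrow> y \<in> A" using A by blast
    define U where "U i = (if i < s then {x i} else UNIV)" for i
    have "{i \<in> UNIV. U i \<noteq> topspace (discrete_topology UNIV)} \<subseteq> {..<s}"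
      by (auto simp: U_def)
    then have "finite {i \<in> UNIV. U i \<noteq> topspace (discrete_topology UNIV)}"
      by (rule finite_subset) simp
    moreover have "x \<in> PiE UNIV U" by (auto simp: U_def)
    moreover have "PiE UNIV U \<subseteq> A"
    proof
      fix y assume "y \<in> PiE UNIV U"
      then have "y i \<in> U i" for i by auto
      then have "\<forall>i<s. y i = x i" unfolding U_def by (metis singletonD)
      then show "y \<in> A" by (rule s)
    qed
    ultimately show "\<exists>U. finite {i \<in> UNIV. U i \<noteq> topspace (discrete_topology UNIV)} \<and>
        (\<forall>i\<in>UNIV. openin (discrete_topology UNIV) (U i)) \<and> x \<in> PiE UNIV U \<and> PiE UNIV U \<subseteq> A"
      by auto
  qed
qed

lemma continuous_Cantor_ModSpace:
  assumes "\<And>x. f x \<in> topspace (ModSpace \<tau>)"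
    and "\<And>x a. a \<in> atoms \<tau> \<Longrightarrow> \<exists>s. \<forall>y. (\<forall>i<s. y i = x i) \<longrightarrow> f y a = f x a"
  shows "continuous_map Cantor (ModSpace \<tau>) f"
  unfolding ModSpace_def continuous_map_componentwise
proof (intro conjI ballI)
  show "f ` topspace Cantor \<subseteq> extensional (atoms \<tau>)"
    using assms(1) by (auto simp: topspace_ModSpace PiE_def)
next
  fix a assume a: "a \<in> atoms \<tau>"
  show "continuous_map Cantor (discrete_topology UNIV) (\<lambda>x. f x a)"
    unfolding continuous_map_def
  proof (intro conjI allI impI)
    fix U :: "bool set"
    have "\<exists>s. \<forall>y. (\<forall>i<s. y i = x i) \<longrightarrow> f y a \<in> U" if "f x a \<in> U" for x
    proof -
      obtain s where s: "\<forall>y. (\<forall>i<s. y i = x i) \<longrightarrow> f y a = f x a"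
        using assms(2)[OF a, of x] by (rule exE)
      show ?thesis
      proof (intro exI allI impI)
        fix y assume "\<forall>i<s. y i = x i"
        then have "f y a = f x a" using s by blast
        then show "f y a \<in> U" using that by (simp only:)
      qed
    qed
    then show "openin Cantor {x \<in> topspace Cantor. f x a \<in> U}"
      unfolding openin_Cantor by (simp add: topspace_Cantor)
  qed simp
qed

text \<open>Diagonalising against a universal set: \<open>universal n y\<close> runs through all \<open>\<Sigma>\<^sub>n\<^sub>+\<^sub>1\<close> sets as \<open>y\<close>
  runs through Cantor space.\<close>

primrec universal :: "nat \<Rightarrow> (nat \<Rightarrow> bool) \<Rightarrow> (nat \<Rightarrow> bool) set" where
  "universal 0 y = {x. \<exists>\<sigma>::bool list. y (to_nat \<sigma>) \<and> (\<forall>i<length \<sigma>. x i = \<sigma> ! i)}"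
| "universal (Suc n) y = {x. \<exists>j. x \<notin> universal n (\<lambda>k. y (prod_encode (j, k)))}"

lemma bSigma_imp_universal: "A \<in> bSigma Cantor (Suc n) \<Longrightarrow> \<exists>y. A = universal n y"
proof (induction n arbitrary: A)
  case 0
  then have A: "openin Cantor A" by simp
  define y where "y k \<longleftrightarrow> {x. \<forall>i<length (from_nat k :: bool list). x i = (from_nat k :: bool list) ! i} \<subseteq> A" for k
  have "x \<in> universal 0 y" if x: "x \<in> A" for x
  proof -
    obtain s where s: "\<And>z. (\<forall>i<s. z i = x i) \<Longrightarrow> z \<in> A"
      using A x unfolding openin_Cantor by blast
    have "y (to_nat (map x [0..<s]))"
      unfolding y_def from_nat_to_nat
    proof
      fix z assume "z \<in> {z. \<forall>i<length (map x [0..<s]). z i = map x [0..<s] ! i}"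
      then show "z \<in> A" by (intro s) simp
    qed
    moreover have "\<forall>i<length (map x [0..<s]). x i = map x [0..<s] ! i"
      by simp
    ultimately show ?thesis
      unfolding universal.simps by blast
  qed
  moreover have "x \<in> A" if "x \<in> universal 0 y" for x
    using that unfolding universal.simps y_def from_nat_to_nat by blast
  ultimately have "A = universal 0 y" by blast
  then show ?case by blast
next
  case (Suc n)
  then obtain B where B: "A = \<Union>(range B)" "\<And>i::nat. UNIV - B i \<in> bSigma Cantor (Suc n)"
    by (auto simp: topspace_Cantor)
  obtain Y where Y: "\<And>i. UNIV - B i = universal n (Y i)"
    using Suc.IH[OF B(2)] by metis
  have "A = universal (Suc n) (\<lambda>k. Y (fst (prod_decode k)) (snd (prod_decode k)))"
    by (auto simp: B(1) Y[symmetric])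
  then show ?case by blast
qed

text \<open>Only the diagonal \<open>g x = x\<close> is wanted; general codes are allowed because
  the recursion passes from a code to its columns.\<close>

lemma universal_section_bSigma:
  assumes "\<And>k. openin Cantor {x. g x k}" "\<And>k. openin Cantor {x. \<not> g x k}"
  shows "{x. x \<in> universal n (g x)} \<in> bSigma Cantor (Suc n)"
  using assms
proof (induction n arbitrary: g)
  case 0
  have "openin Cantor {x. \<forall>i<length \<sigma>. x i = \<sigma> ! i}" for \<sigma> :: "bool list"
    unfolding openin_Cantor by (auto intro!: exI[of _ "length \<sigma>"])
  then have "openin Cantor (\<Union>\<sigma>::bool list. {x. g x (to_nat \<sigma>)} \<inter> {x. \<forall>i<length \<sigma>. x i = \<sigma> ! i})"
    using 0 by (intro openin_Union) auto
  moreover have "{x. x \<in> universal 0 (g x)} =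
      (\<Union>\<sigma>::bool list. {x. g x (to_nat \<sigma>)} \<inter> {x. \<forall>i<length \<sigma>. x i = \<sigma> ! i})"
    by auto
  ultimately show ?case by simp
next
  case (Suc n)
  define B where "B j = {x. x \<notin> universal n (\<lambda>k. g x (prod_encode (j, k)))}" for j
  have "UNIV - B j = {x. x \<in> universal n (\<lambda>k. g x (prod_encode (j, k)))}" for j
    by (auto simp: B_def)
  then have "UNIV - B j \<in> bSigma Cantor (Suc n)" for j
    using Suc.IH[of "\<lambda>x k. g x (prod_encode (j, k))"] Suc.prems by auto
  moreover have "{x. x \<in> universal (Suc n) (g x)} = \<Union>(range B)"
    by (auto simp: B_def)
  ultimately show ?case
    by (auto simp: topspace_Cantor)
qed

text \<open>The diagonal set \<open>E\<close> reduces to \<open>B\<close>. If \<open>B\<close> were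
  in the dual class, the complement of \<open>E\<close> would have a code \<open>y\<close>, and
  membership of \<open>y\<close> in \<open>E\<close> would be contradictory.\<close>

lemma hard_bSigma_imp_notin_bPi:
  assumes "hard (bSigma Cantor (Suc n)) Y B"
  shows "B \<notin> bPi Y (Suc n)"
proof
  assume B: "B \<in> bPi Y (Suc n)"
  define E where "E = {x. x \<in> universal n x}"
  have "E \<in> bSigma Cantor (Suc n)"
    unfolding E_def
  proof (rule universal_section_bSigma)
    fix k :: nat
    show "openin Cantor {x. x k}" "openin Cantor {x. \<not> x k}"
      unfolding openin_Cantor by (auto intro!: exI[of _ "Suc k"])
  qed
  then obtain f where f: "continuous_map Cantor Y f" "\<And>x. x \<in> E \<longleftrightarrow> f x \<in> B"
    using assms unfolding hard_def by (auto simp: topspace_Cantor)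
  have "{x \<in> topspace Cantor. f x \<in> topspace Y - B} \<in> bSigma Cantor (Suc n)"
    by (rule bSigma_vimage[OF f(1)]) (use B in \<open>simp add: bPi_def\<close>)
  moreover have "{x \<in> topspace Cantor. f x \<in> topspace Y - B} = UNIV - E"
    using f unfolding continuous_map_def by (auto simp: topspace_Cantor)
  ultimately obtain y where "UNIV - E = universal n y"
    using bSigma_imp_universal by metis
  then show False by (auto simp: E_def set_eq_iff)
qed

section \<open>Borel complexity of satisfaction\<close>

text \<open>Truth and falsity are carried through the induction together because \<open>Neg\<close>
  and \<open>Imp\<close> exchange them.\<close>

lemma openin_sat_qfree:
  assumes "qfree p" "wf_fm \<tau> p"
  shows "openin (ModSpace \<tau>) {M \<in> topspace (ModSpace \<tau>). sat M e p}"
    and "openin (ModSpace \<tau>) {M \<in> topspace (ModSpace \<tau>). \<not> sat M e p}"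
proof -
  let ?X = "ModSpace \<tau>"
  define op where "op P \<longleftrightarrow> openin ?X {M \<in> topspace ?X. P M}" for P
  have conj: "op (\<lambda>M. P M \<and> Q M)" and disj: "op (\<lambda>M. P M \<or> Q M)" if "op P" "op Q" for P Q
  proof -
    have "{M \<in> topspace ?X. P M \<and> Q M} = {M \<in> topspace ?X. P M} \<inter> {M \<in> topspace ?X. Q M}"
      "{M \<in> topspace ?X. P M \<or> Q M} = {M \<in> topspace ?X. P M} \<union> {M \<in> topspace ?X. Q M}"
      by auto
    then show "op (\<lambda>M. P M \<and> Q M)" "op (\<lambda>M. P M \<or> Q M)"
      using that unfolding op_def by auto
  qed
  have "op (\<lambda>M. sat M e p) \<and> op (\<lambda>M. \<not> sat M e p)"
    using assms
  proof (induction p)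
    case (Eq x y)
    then show ?case by (cases "e x = e y") (auto simp: op_def)
  next
    case (Rel R xs)
    then have a: "(R, map e xs) \<in> atoms \<tau>" by (simp add: atoms_def)
    have c: "continuous_map ?X (discrete_topology UNIV) (\<lambda>M. M (R, map e xs))"
      unfolding ModSpace_def by (rule continuous_map_product_projection[OF a])
    show ?case
      using openin_continuous_map_preimage[OF c, of "{True}"] openin_continuous_map_preimage[OF c, of "{False}"]
      by (simp add: op_def)
  next
    case (Conj p q)
    then have sub: "op (\<lambda>M. sat M e p)" "op (\<lambda>M. \<not> sat M e p)" "op (\<lambda>M. sat M e q)" "op (\<lambda>M. \<not> sat M e q)"
      by simp_all
    show ?case
      using conj[OF sub(1,3)] disj[OF sub(2,4)] by simp
  next
    case (Disj p q)
    then have sub: "op (\<lambda>M. sat M e p)" "op (\<lambda>M. \<not> sat M e p)" "op (\<lambda>M. sat M e q)" "op (\<lambda>M. \<not> sat M e q)"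
      by simp_all
    show ?case
      using disj[OF sub(1,3)] conj[OF sub(2,4)] by simp
  next
    case (Imp p q)
    then have sub: "op (\<lambda>M. sat M e p)" "op (\<lambda>M. \<not> sat M e p)" "op (\<lambda>M. sat M e q)" "op (\<lambda>M. \<not> sat M e q)"
      by simp_all
    show ?case
      using disj[OF sub(2,3)] conj[OF sub(1,4)] by simp
  qed auto
  then show "openin ?X {M \<in> topspace ?X. sat M e p}" "openin ?X {M \<in> topspace ?X. \<not> sat M e p}"
    unfolding op_def by auto
qed

lemma bSigma_imp_bPi_Suc: "A \<in> bSigma X (Suc n) \<Longrightarrow> A \<in> bPi X (Suc (Suc n))"
  using bPi_Suc_imp_bSigma[of "topspace X - A" X n] bSigma_subset[of A X "Suc n"]
  by (simp add: bPi_def double_diff)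

lemma topspace_diff_Collect: "topspace X - {M \<in> topspace X. P M} = {M \<in> topspace X. \<not> P M}"
  by auto

text \<open>Level \<open>0\<close> is separate because \<open>bSigma X 0\<close> is empty.\<close>

lemma sat_prenex_bPi_bSigma:
  "univ_n n p \<Longrightarrow> wf_fm \<tau> p \<Longrightarrow>
    if n = 0 then qfree p else \<forall>e. {M \<in> topspace (ModSpace \<tau>). sat M e p} \<in> bPi (ModSpace \<tau>) n"
  "exi_n n p \<Longrightarrow> wf_fm \<tau> p \<Longrightarrow>
    if n = 0 then qfree p else \<forall>e. {M \<in> topspace (ModSpace \<tau>). sat M e p} \<in> bSigma (ModSpace \<tau>) n"
proof (induction rule: univ_n_exi_n.inducts)
  case (2 n p)
  show ?case
  proof (cases n)
    case 0
    then show ?thesis using 2 by (simp add: bPi_def topspace_diff_Collect openin_sat_qfree)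
  next
    case (Suc m)
    then show ?thesis using 2 by (simp add: bSigma_imp_bPi_Suc del: bSigma.simps)
  qed
next
  case (3 n p x)
  have "{M \<in> topspace (ModSpace \<tau>). \<forall>a\<in>UNIV. sat M (e(x := a)) p} \<in> bPi (ModSpace \<tau>) (Suc n)" for e
    by (rule bPi_INT) (use 3 in auto)
  then show ?case by simp
next
  case (5 n p)
  show ?case
  proof (cases n)
    case 0
    then show ?thesis using 5 by (simp add: openin_sat_qfree)
  next
    case (Suc m)
    then show ?thesis using 5 by (simp add: bPi_Suc_imp_bSigma del: bSigma.simps)
  qed
next
  case (6 n p x)
  have "(\<Union>a. {M \<in> topspace (ModSpace \<tau>). sat M (e(x := a)) p}) \<in> bSigma (ModSpace \<tau>) (Suc n)" for e
    by (rule bSigma_UN) (use 6 in auto)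
  moreover have "(\<Union>a. {M \<in> topspace (ModSpace \<tau>). sat M (e(x := a)) p}) =
      {M \<in> topspace (ModSpace \<tau>). sat M e (Ex x p)}" for e
    by auto
  ultimately show ?case by auto
qed auto

lemma has_univ_axiomatization_imp_bPi:
  assumes "has_univ_axiomatization \<tau> T (Suc n)"
  shows "Mod \<tau> T \<in> bPi (ModSpace \<tau>) (Suc n)"
proof -
  obtain S where S: "\<And>p. p \<in> S \<Longrightarrow> sentence \<tau> p \<and> univ_n (Suc n) p" "Mod \<tau> S = Mod \<tau> T"
    using assms unfolding has_univ_axiomatization_def by blast
  have "Mod \<tau> S = {M \<in> topspace (ModSpace \<tau>). \<forall>p\<in>S. sat M (\<lambda>_. 0) p}"
    unfolding Mod_def using S(1) sat_sentence unfolding sentence_def by blast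
  also have "\<dots> \<in> bPi (ModSpace \<tau>) (Suc n)"
    using S(1) sat_prenex_bPi_bSigma(1)[of "Suc n"] by (intro bPi_INT) (auto simp: sentence_def)
  finally show ?thesis
    using S(2) by simp
qed

subsection \<open>Ultraproducts and a back-and-forth saturated countable pair\<close>

locale free_ultrafilter =
  fixes F :: "nat filter"
  assumes le_sequentially: "F \<le> sequentially"
    and nontrivial: "F \<noteq> bot"
    and ultra: "eventually P F \<or> eventually (\<lambda>n. \<not> P n) F"

text \<open>Zorn's lemma in the reversed order: finer filters are smaller, so an ultrafilter is a
  minimal proper filter.\<close>

lemma free_ultrafilter_exists: "\<exists>F. free_ultrafilter F"
proof -
  define A where "A = {F :: nat filter. F \<le> sequentially \<and> F \<noteq> bot}"
  have "\<exists>m\<in>A. \<forall>a\<in>A. m \<ge> a \<longrightarrow> a = m"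
  proof (rule predicate_Zorn)
    show "partial_order_on A (relation_of (\<ge>) A)"
      by (rule partial_order_on_relation_ofI) auto
  next
    fix C assume C: "C \<in> Chains (relation_of (\<ge>) A)"
    then have CA: "C \<subseteq> A" and chain: "\<And>F G. F \<in> C \<Longrightarrow> G \<in> C \<Longrightarrow> F \<le> G \<or> G \<le> F"
      by (auto simp: Chains_def relation_of_def)
    show "\<exists>u\<in>A. \<forall>a\<in>C. u \<le> a"
    proof (cases "C = {}")
      case True
      have "sequentially \<in> A" by (simp add: A_def)
      then show ?thesis using True by blast
    next
      case False
      \<comment> \<open>A chain is directed, so whatever holds eventually for its infimum does so
        for a member; hence the infimum is proper.\<close>
      have "eventually P (Inf C) \<longleftrightarrow> (\<exists>b\<in>C. eventually P b)" for P
      proof (rule eventually_Inf_base[OF False])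
        fix F G assume "F \<in> C" "G \<in> C"
        then show "\<exists>x\<in>C. x \<le> inf F G"
          using chain[of F G] by auto
      qed
      then have "Inf C \<noteq> bot"
        using CA unfolding A_def trivial_limit_def by blast
      moreover have "Inf C \<le> sequentially"
        using False CA Inf_lower order_trans unfolding A_def by blast
      ultimately show ?thesis
        using Inf_lower unfolding A_def by blast
    qed
  qed
  then obtain F where F: "F \<in> A" "\<And>G. G \<in> A \<Longrightarrow> G \<le> F \<Longrightarrow> G = F"
    by blast
  have "eventually (\<lambda>n. \<not> P n) F" if P: "\<not> eventually P F" for P
  proof -
    \<comment> \<open>Adding the complement of \<open>P\<close> keeps the filter proper, so by
      minimality it was there already.\<close>
    let ?G = "inf F (principal {n. \<not> P n})"
    have "?G \<noteq> bot"
      using P by (simp add: trivial_limit_def eventually_inf_principal)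
    then have "?G = F"
      using F(1) by (intro F(2)) (auto simp: A_def intro: le_infI1)
    moreover have "eventually (\<lambda>n. \<not> P n) ?G"
      by (simp add: eventually_inf_principal)
    ultimately show ?thesis by simp
  qed
  then have "free_ultrafilter F"
    using F(1) unfolding A_def by unfold_locales auto
  then show ?thesis by blast
qed

lemma sat_foldr_Ex:
  "sat M e (foldr Ex xs p) \<longleftrightarrow> (\<exists>e'. (\<forall>v. v \<notin> set xs \<longrightarrow> e' v = e v) \<and> sat M e' p)"
proof (induction xs arbitrary: e)
  case Nil
  have "e' = e" if "\<forall>v. e' v = e v" for e'
    using that by blast
  then show ?case by auto
next
  case (Cons x xs)
  have "(\<exists>a. \<forall>v. v \<notin> set xs \<longrightarrow> e' v = (e(x := a)) v) \<longleftrightarrow> (\<forall>v. v \<notin> set (x # xs) \<longrightarrow> e' v = e v)" for e'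
    by (auto intro!: exI[of _ "e' x"])
  then show ?case
    by (simp add: Cons.IH) blast
qed

lemma foldr_Ex_simps:
  "exi_n (Suc n) p \<Longrightarrow> exi_n (Suc n) (foldr Ex xs p)"
  "fv (foldr Ex xs p) = fv p - set xs"
  "wf_fm \<tau> (foldr Ex xs p) = wf_fm \<tau> p"
  by (induction xs) (auto intro: univ_n_exi_n.intros)

text \<open>A Skolem hull: chosen witnesses are added countably often. With tuples as parameters and
  as witnesses it serves both for elementarity and for extending tuples in back-and-forth.\<close>

lemma countable_closure:
  fixes P :: "'i::countable \<Rightarrow> 'a list \<Rightarrow> 'a list \<Rightarrow> bool"
  assumes "countable C\<^sub>0"
  obtains C where "countable C" "C\<^sub>0 \<subseteq> C"
    "\<And>i l w. l \<in> lists C \<Longrightarrow> P i l w \<Longrightarrow> \<exists>w\<in>lists C. P i l w"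
proof -
  define W where "W i l = (SOME w. P i l w)" for i l
  define step where "step C = C \<union> (\<Union>i. \<Union>l\<in>lists C. set (W i l))" for C
  define D where "D n = (step ^^ n) C\<^sub>0" for n
  define C where "C = (\<Union>n. D n)"
  have D: "D 0 = C\<^sub>0" "D (Suc n) = step (D n)" for n
    by (simp_all add: D_def)
  have "countable (D n)" for n
  proof (induction n)
    case (Suc n)
    then show ?case
      unfolding D step_def by (intro countable_Un countable_UN countable_lists) (simp_all add: countable_finite)
  qed (simp add: D assms)
  then have "countable C"
    unfolding C_def by simp
  moreover have "C\<^sub>0 \<subseteq> C"
    unfolding C_def using D(1) by blast
  moreover have "\<exists>w\<in>lists C. P i l w" if l: "l \<in> lists C" and P: "P i l w" for i l w
  proof -
    have mono: "D m \<subseteq> D n" if "m \<le> n" for m n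
      by (rule lift_Suc_mono_le[OF _ that]) (auto simp: D step_def)
    from l have "\<exists>n. l \<in> lists (D n)"
    proof (induction l)
      case (Cons a l)
      then obtain n m where "l \<in> lists (D n)" "a \<in> D m"
        unfolding C_def by auto
      then have "a # l \<in> lists (D (max m n))"
        using mono[of n "max m n"] mono[of m "max m n"] by auto
      then show ?case by blast
    qed auto
    then obtain n where "l \<in> lists (D n)" by blast
    then have "set (W i l) \<subseteq> D (Suc n)"
      unfolding D step_def by blast
    then have "W i l \<in> lists C"
      unfolding C_def by auto
    moreover have "P i l (W i l)"
      unfolding W_def using P by (rule someI)
    ultimately show ?thesis by blast
  qed
  ultimately show thesis by (rule that)
qed

text \<open>\<open>d\<close> is a mere filler: the formulas evaluated at a tuple have their free
  variables below its length. The same padding later turns bit strings into points of Cantor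
  space.\<close>

definition env :: "'a \<Rightarrow> 'a list \<Rightarrow> nat \<Rightarrow> 'a" where
  "env d l v = (if v < length l then l ! v else d)"

section \<open>Ultraproducts: the theorem of Los and countable saturation\<close>

context free_ultrafilter
begin

lemma eventually_not_iff: "eventually (\<lambda>n. \<not> P n) F \<longleftrightarrow> \<not> eventually P F"
proof
  assume "eventually (\<lambda>n. \<not> P n) F"
  then show "\<not> eventually P F"
    using nontrivial eventually_elim2[of P F "\<lambda>n. \<not> P n" "\<lambda>_. False"] by (auto simp: trivial_limit_def)
qed (use ultra in blast)

lemma eventually_ge: "eventually (\<lambda>n. k \<le> n) F"
  using le_sequentially eventually_ge_at_top filter_leD by blast

text \<open>Satisfaction in the ultraproduct, with sequences as elements and no quotient taken. The
  criterion of Los is the definition, and the following lemmas recover Tarski's clauses.\<close>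

definition usat :: "(nat \<Rightarrow> nat \<times> nat list \<Rightarrow> bool) \<Rightarrow> (nat \<Rightarrow> nat \<Rightarrow> nat) \<Rightarrow> fm \<Rightarrow> bool" where
  "usat A e p \<longleftrightarrow> eventually (\<lambda>n. sat (A n) (\<lambda>v. e v n) p) F"

lemma usat_Neg: "usat A e (Neg p) \<longleftrightarrow> \<not> usat A e p"
  by (simp add: usat_def eventually_not_iff)

lemma usat_Conj: "usat A e (Conj p q) \<longleftrightarrow> usat A e p \<and> usat A e q"
  by (simp add: usat_def eventually_conj_iff)

lemma usat_Disj: "usat A e (Disj p q) \<longleftrightarrow> usat A e p \<or> usat A e q"
proof -
  have "usat A e (Disj p q) \<longleftrightarrow> usat A e (Neg (Conj (Neg p) (Neg q)))"
    by (simp add: usat_def)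
  then show ?thesis by (simp only: usat_Neg usat_Conj) blast
qed

lemma usat_Imp: "usat A e (Imp p q) \<longleftrightarrow> (usat A e p \<longrightarrow> usat A e q)"
proof -
  have "usat A e (Imp p q) \<longleftrightarrow> usat A e (Disj (Neg p) q)"
    by (simp add: usat_def)
  then show ?thesis by (simp only: usat_Neg usat_Disj) blast
qed

lemma usat_Ex: "usat A e (Ex x p) \<longleftrightarrow> (\<exists>g. usat A (e(x := g)) p)"
proof -
  have upd: "(\<lambda>v. (e(x := g)) v n) = (\<lambda>v. e v n)(x := g n)" for g n
    by auto
  show ?thesis
  proof
    assume "usat A e (Ex x p)"
    then have *: "eventually (\<lambda>n. \<exists>a. sat (A n) ((\<lambda>v. e v n)(x := a)) p) F"
      by (simp add: usat_def)
    define g where "g n = (SOME a. sat (A n) ((\<lambda>v. e v n)(x := a)) p)" for n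
    have "usat A (e(x := g)) p"
      unfolding usat_def upd using * by (rule eventually_mono) (auto simp: g_def intro: someI)
    then show "\<exists>g. usat A (e(x := g)) p" by blast
  next
    assume "\<exists>g. usat A (e(x := g)) p"
    then show "usat A e (Ex x p)"
      unfolding usat_def upd by (auto elim: eventually_mono)
  qed
qed

lemma usat_All: "usat A e (All x p) \<longleftrightarrow> (\<forall>g. usat A (e(x := g)) p)"
proof -
  have "usat A e (All x p) \<longleftrightarrow> usat A e (Neg (Ex x (Neg p)))"
    by (simp add: usat_def)
  then show ?thesis by (simp only: usat_Neg usat_Ex) blast
qed

lemma usat_cong:
  assumes "\<And>v. v \<in> fv p \<Longrightarrow> eventually (\<lambda>n. e v n = e' v n) F"
  shows "usat A e p \<longleftrightarrow> usat A e' p"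
proof -
  have "eventually (\<lambda>n. \<forall>v\<in>fv p. e v n = e' v n) F"
    using assms finite_fv by (simp add: eventually_ball_finite)
  then have "eventually (\<lambda>n. sat (A n) (\<lambda>v. e v n) p \<longleftrightarrow> sat (A n) (\<lambda>v. e' v n) p) F"
    by (rule eventually_mono) (auto intro!: sat_cong)
  then show ?thesis
    unfolding usat_def by (rule eventually_cong) auto
qed

lemma usat_cong_eq: "(\<And>v. v \<in> fv p \<Longrightarrow> e v = e' v) \<Longrightarrow> usat A e p \<longleftrightarrow> usat A e' p"
  by (rule usat_cong) auto

text \<open>Countable saturation by diagonalisation: coordinate \<open>n\<close> satisfies the
  longest initial segment of an enumeration of \<open>\<Phi>\<close>, up to index \<open>n\<close>,
  that can be satisfied there over the fixed values.\<close>

lemma usat_saturated: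
  assumes "\<And>ps. set ps \<subseteq> \<Phi> \<Longrightarrow> ps \<noteq> [] \<Longrightarrow>
      eventually (\<lambda>n. \<exists>e'. (\<forall>v<r. e' v = e v n) \<and> (\<forall>p\<in>set ps. sat (A n) e' p)) F"
  shows "\<exists>e'. (\<forall>v<r. e' v = e v) \<and> (\<forall>p\<in>\<Phi>. usat A e' p)"
proof (cases "\<Phi> = {}")
  case False
  define ps where "ps i = map (from_nat_into \<Phi>) [0..<Suc i]" for i
  define G where "G i n e' \<longleftrightarrow> (\<forall>v<r. e' v = e v n) \<and> (\<forall>p\<in>set (ps i). sat (A n) e' p)" for i n e'
  \<comment> \<open>The segments \<open>ps i\<close> increase with \<open>i\<close>, so an
    assignment for the largest satisfiable index serves all smaller ones; the bound \<open>n\<close>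
    makes the maximum exist.\<close>
  have "\<exists>e'. (\<forall>v<r. e' v = e v n) \<and> (\<forall>i\<le>n. (\<exists>e'. G i n e') \<longrightarrow> G i n e')" for n
  proof (cases "\<exists>i\<le>n. \<exists>e'. G i n e'")
    case True
    define I where "I = {i. i \<le> n \<and> (\<exists>e'. G i n e')}"
    have I: "finite I" "I \<noteq> {}"
      unfolding I_def using True by auto
    then obtain e' where e': "G (Max I) n e'"
      using Max_in[OF I] unfolding I_def by blast
    have "G i n e'" if "i \<in> I" for i
    proof -
      have "set (ps i) \<subseteq> set (ps (Max I))"
        using Max_ge[OF I(1) that] unfolding ps_def set_map set_upt by (intro image_mono) auto
      then show ?thesis
        using e' unfolding G_def by blast
    qed
    moreover have "\<forall>v<r. e' v = e v n"
      using e' by (simp add: G_def)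
    ultimately show ?thesis
      unfolding I_def by blast
  next
    case False
    then show ?thesis by (intro exI[of _ "\<lambda>v. e v n"]) auto
  qed
  then obtain E where E: "\<And>n v. v < r \<Longrightarrow> E n v = e v n"
      "\<And>n i e'. i \<le> n \<Longrightarrow> G i n e' \<Longrightarrow> G i n (E n)"
    by metis
  have "usat A (\<lambda>v n. E n v) p" if p: "p \<in> \<Phi>" for p
  proof -
    obtain i where i: "p = from_nat_into \<Phi> i"
      using p from_nat_into_surj[of \<Phi> p] by auto
    have "set (ps i) \<subseteq> \<Phi>" "ps i \<noteq> []"
      using from_nat_into[OF False] by (auto simp: ps_def)
    then have "eventually (\<lambda>n. \<exists>e'. G i n e') F"
      using assms unfolding G_def by blast
    \<comment> \<open>Freeness of \<open>F\<close> enters here: almost all coordinates are at least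
      \<open>i\<close>, and there the choice \<open>E n\<close> takes segment \<open>i\<close> into
      account.\<close>
    then show ?thesis
      unfolding usat_def using eventually_ge[of i]
    proof eventually_elim
      case (elim n)
      then have "G i n (E n)" using E(2) by blast
      moreover have "p \<in> set (ps i)" by (simp add: ps_def i)
      ultimately show ?case unfolding G_def by simp
    qed
  qed
  moreover have "\<forall>v<r. (\<lambda>n. E n v) = e v"
    using E(1) by auto
  ultimately show ?thesis
    by (intro exI[of _ "\<lambda>v n. E n v"]) blast
qed auto

definition ule :: "vocab \<Rightarrow> nat \<Rightarrow> nat \<Rightarrow> (nat \<Rightarrow> nat \<times> nat list \<Rightarrow> bool) \<Rightarrow> (nat \<Rightarrow> nat \<Rightarrow> nat) \<Rightarrow>
    (nat \<Rightarrow> nat \<times> nat list \<Rightarrow> bool) \<Rightarrow> (nat \<Rightarrow> nat \<Rightarrow> nat) \<Rightarrow> bool" where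
  "ule \<tau> k r A e B e' \<longleftrightarrow>
     (\<forall>p. univ_n k p \<and> wf_fm \<tau> p \<and> fv p \<subseteq> {..<r} \<longrightarrow> usat A e p \<longrightarrow> usat B e' p)"

text \<open>A finite part of the type of the longer tuple in \<open>B\<close> gives an existential
  formula of level \<open>k + 1\<close> about the short tuple. Its negation is universal, so it
  cannot hold in \<open>A\<close>; saturation then realises the whole type.\<close>

lemma ule_back_and_forth:
  assumes le: "ule \<tau> (Suc k) r A e B e'" and "r \<le> r'"
  shows "\<exists>e''. (\<forall>v<r. e'' v = e v) \<and> ule \<tau> k r' B e' A e''"
proof -
  define \<Phi> where "\<Phi> = {p. univ_n k p \<and> wf_fm \<tau> p \<and> fv p \<subseteq> {..<r'} \<and> usat B e' p}"
  have "\<exists>e''. (\<forall>v<r. e'' v = e v) \<and> (\<forall>p\<in>\<Phi>. usat A e'' p)"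
  proof (rule usat_saturated)
    fix ps assume ps: "set ps \<subseteq> \<Phi>" "ps \<noteq> []"
    obtain c where c: "univ_n k c" "wf_fm \<tau> c" "fv c \<subseteq> {..<r'}" "\<And>M e. sat M e c = (\<forall>p\<in>set ps. sat M e p)"
      using prenex_junct_list[of ps k \<tau> "{..<r'}" True] ps unfolding \<Phi>_def by (simp add: subset_iff) blast
    \<comment> \<open>The variables from \<open>r\<close> to \<open>r' - 1\<close> are the new
      entries of the tuple and are quantified away.\<close>
    define q where "q = foldr Ex [r..<r'] c"
    have q: "exi_n (Suc k) q" "fv q \<subseteq> {..<r}" "wf_fm \<tau> q"
      unfolding q_def foldr_Ex_simps(2,3)
      using c foldr_Ex_simps(1)[OF univ_n_exi_n.intros(5)[OF c(1)]] by auto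
    obtain q' where q': "univ_n (Suc k) q'" "\<And>M e. sat M e q' = (\<not> sat M e q)" "fv q' = fv q" "wf_fm \<tau> q' = wf_fm \<tau> q"
      using prenex_neg(2)[OF q(1), of \<tau>] by blast
    have "usat B e' c"
      using ps unfolding usat_def c(4) \<Phi>_def by (intro eventually_ball_finite) auto
    then have "usat B e' q"
      unfolding usat_def q_def sat_foldr_Ex by (auto elim!: eventually_mono)
    then have "\<not> usat B e' q'"
      by (simp add: usat_def q' eventually_not_iff)
    then have "\<not> usat A e q'"
      using le q q' unfolding ule_def by auto
    then have "usat A e q"
      by (simp add: usat_def q' eventually_not_iff)
    then show "eventually (\<lambda>n. \<exists>e'. (\<forall>v<r. e' v = e v n) \<and> (\<forall>p\<in>set ps. sat (A n) e' p)) F"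
      unfolding usat_def q_def sat_foldr_Ex c(4)
    proof (rule eventually_mono)
      fix n assume "\<exists>e'. (\<forall>v. v \<notin> set [r..<r'] \<longrightarrow> e' v = e v n) \<and> (\<forall>p\<in>set ps. sat (A n) e' p)"
      then obtain e' where "\<forall>v. v \<notin> set [r..<r'] \<longrightarrow> e' v = e v n" "\<forall>p\<in>set ps. sat (A n) e' p"
        by blast
      then show "\<exists>e'. (\<forall>v<r. e' v = e v n) \<and> (\<forall>p\<in>set ps. sat (A n) e' p)"
        by (intro exI[of _ e']) simp
    qed
  qed
  then show ?thesis
    unfolding ule_def \<Phi>_def by blast
qed

lemma ule_cong:
  assumes "\<And>v. v < r \<Longrightarrow> eventually (\<lambda>n. e v n = d v n) F"
    and "\<And>v. v < r \<Longrightarrow> eventually (\<lambda>n. e' v n = d' v n) F"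
  shows "ule \<tau> k r A e B e' \<longleftrightarrow> ule \<tau> k r A d B d'"
proof -
  have "usat A e p \<longleftrightarrow> usat A d p" "usat B e' p \<longleftrightarrow> usat B d' p" if "fv p \<subseteq> {..<r}" for p
    using assms that by (auto intro!: usat_cong)
  then show ?thesis
    unfolding ule_def by blast
qed

end

text \<open>A first-order form of the back-and-forth preorder of level \<open>k\<close>. Only the
  first \<open>length l\<close> entries of \<open>l'\<close> are compared, so lengthening
  \<open>l'\<close> preserves the relation.\<close>

definition type_le :: "vocab \<Rightarrow> nat \<Rightarrow> (nat \<times> nat list \<Rightarrow> bool) \<Rightarrow> nat list \<Rightarrow>
    (nat \<times> nat list \<Rightarrow> bool) \<Rightarrow> nat list \<Rightarrow> bool" where
  "type_le \<tau> k M l N l' \<longleftrightarrow> length l \<le> length l' \<and>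
     (\<forall>p. univ_n k p \<and> wf_fm \<tau> p \<and> fv p \<subseteq> {..<length l} \<longrightarrow> sat M (env 0 l) p \<longrightarrow> sat N (env 0 l') p)"

section \<open>Countable elementary substructures of two ultraproducts\<close>

context free_ultrafilter
begin

text \<open>One countable set \<open>C\<close> of sequences carries both substructures. It is closed
  under Tarski-Vaught witnesses and back-and-forth extensions, and \<open>C\<close> modulo equality
  almost everywhere is then identified with the natural numbers.\<close>

lemma countable_saturated_family:
  fixes A :: "bool \<Rightarrow> nat \<Rightarrow> nat \<times> nat list \<Rightarrow> bool"
  obtains S where "\<And>b. S b \<in> topspace (ModSpace \<tau>)"
    and "\<And>b p. sentence \<tau> p \<Longrightarrow> sat (S b) e p \<longleftrightarrow> eventually (\<lambda>n. sat (A b n) e p) F"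
    and "\<And>b b' k l l'. type_le \<tau> (Suc k) (S b) l (S b') l' \<Longrightarrow>
           \<exists>m. length (l @ m) = length l' \<and> type_le \<tau> k (S b') l' (S b) (l @ m)"
proof -
  define eqv where "eqv g g' \<longleftrightarrow> eventually (\<lambda>n. g n = g' n) F" for g g' :: "nat \<Rightarrow> nat"
  have eqv_refl: "eqv g g" for g by (simp add: eqv_def)
  have eqv_sym: "eqv g' g" if "eqv g g'" for g g'
    using that by (simp add: eqv_def eq_commute)
  have eqv_trans: "eqv f h" if "eqv f g" "eqv g h" for f g h
    using that unfolding eqv_def by eventually_elim simp
  let ?env = "env (\<lambda>_. 0 :: nat)"
  \<comment> \<open>\<open>Inl\<close> asks for a Tarski-Vaught witness. \<open>Inr\<close> asks for
    a back-and-forth extension; both tuples are packed into the single list \<open>l\<close>, with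
    \<open>r\<close> as the place to cut.\<close>
  define P where "P i l w = (case i of
      Inl (b, p, x) \<Rightarrow> \<exists>g. w = [g] \<and> usat (A b) ((?env l)(x := g)) p
    | Inr (b, b', k, r) \<Rightarrow> length (take r l @ w) = length (drop r l) \<and>
        ule \<tau> k (length (drop r l)) (A b') (?env (drop r l)) (A b) (?env (take r l @ w)))"
    for i :: "bool \<times> fm \<times> nat + bool \<times> bool \<times> nat \<times> nat" and l w
  \<comment> \<open>Constant sequences are put into \<open>C\<close> because they are pairwise
    inequivalent, which makes the quotient infinite and hence in bijection with the natural
    numbers.\<close>
  have "countable (range (\<lambda>i::nat. \<lambda>_::nat. i))" by simp
  then obtain C where C: "countable C" "range (\<lambda>i. \<lambda>_. i) \<subseteq> C"
      and closed: "\<And>i l w. l \<in> lists C \<Longrightarrow> P i l w \<Longrightarrow> \<exists>w\<in>lists C. P i l w"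
    using countable_closure[of _ P] by metis
  \<comment> \<open>\<open>rep\<close> selects one element of \<open>C\<close> from each class, so
    that \<open>h\<close> enumerates the classes without repetition.\<close>
  define rep where "rep g = (SOME g'. g' \<in> C \<and> eqv g g')" for g
  have rep: "rep g \<in> C" "eqv g (rep g)" if "g \<in> C" for g
    using someI[of "\<lambda>g'. g' \<in> C \<and> eqv g g'" g] that eqv_refl unfolding rep_def by auto
  have rep_eq: "rep g = rep g'" if "eqv g g'" for g g'
  proof -
    have "(\<lambda>h. h \<in> C \<and> eqv g h) = (\<lambda>h. h \<in> C \<and> eqv g' h)"
      using that eqv_sym eqv_trans by blast
    then show ?thesis by (simp add: rep_def)
  qed
  define h where "h = from_nat_into (rep ` C)"
  have "inj (\<lambda>i::nat. rep (\<lambda>_. i))"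
  proof (rule injI)
    fix i j :: nat assume eq: "rep (\<lambda>_. i) = rep (\<lambda>_. j)"
    have "(\<lambda>_. i) \<in> C" "(\<lambda>_. j) \<in> C" using C(2) by auto
    then have "eqv (\<lambda>_. i) (\<lambda>_. j)"
      using rep(2) eq eqv_sym eqv_trans by metis
    then show "i = j"
      using nontrivial by (simp add: eqv_def)
  qed
  then have "infinite (range (\<lambda>i::nat. rep (\<lambda>_. i)))"
    using range_inj_infinite by blast
  moreover have "range (\<lambda>i::nat. rep (\<lambda>_. i)) \<subseteq> rep ` C"
    using C(2) by auto
  ultimately have inf: "infinite (rep ` C)"
    using finite_subset by blast
  then have bij: "bij_betw h UNIV (rep ` C)"
    unfolding h_def by (intro bij_betw_from_nat_into) (use C(1) in auto)
  have h_C: "h i \<in> C" for i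
    using bij_betw_apply[OF bij, of i] rep(1) by auto
  have h_inj: "eqv (h i) (h j) \<longleftrightarrow> i = j" for i j
  proof
    assume ij: "eqv (h i) (h j)"
    obtain g g' where g: "g \<in> C" "h i = rep g" "g' \<in> C" "h j = rep g'"
      using bij_betw_apply[OF bij, of i] bij_betw_apply[OF bij, of j] by auto
    then have "eqv g g'"
      using ij rep(2) eqv_sym eqv_trans by metis
    then have "h i = h j"
      using g rep_eq by simp
    then show "i = j"
      using bij by (auto simp: bij_betw_def inj_eq)
  qed (simp add: eqv_refl)
  have h_surj: "\<exists>i. eqv (h i) g" if g: "g \<in> C" for g
  proof -
    have "rep g \<in> range h"
      using bij g by (auto simp: bij_betw_def)
    then obtain i where "h i = rep g" by auto
    then show ?thesis
      using rep(2)[OF g] eqv_sym by metis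
  qed
  define S where "S b a = (if a \<in> atoms \<tau> then eventually (\<lambda>n. A b n (fst a, map (\<lambda>i. h i n) (snd a))) F
      else undefined)" for b a
  \<comment> \<open>The Tarski-Vaught test. Only finitely many variables are free in
    \<open>p\<close>, so the assignment can be cut down to a list over \<open>C\<close>.\<close>
  have Ex_C: "\<exists>i. usat (A b) ((h \<circ> e)(x := h i)) p" if g: "usat (A b) ((h \<circ> e)(x := g)) p" for b e x g p
  proof -
    obtain N where N: "\<And>v. v \<in> fv p \<Longrightarrow> v < N"
      using finite_fv[of p] unfolding finite_nat_set_iff_bounded by blast
    define l where "l = map (h \<circ> e) [0..<N]"
    have l: "?env l v = h (e v)" if "v \<in> fv p" for v
      using N[OF that] by (simp add: l_def env_def)
    have "usat (A b) ((?env l)(x := g)) p"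
      using g by (subst usat_cong_eq[where e' = "(h \<circ> e)(x := g)"]) (auto simp: l)
    then have "P (Inl (b, p, x)) l [g]"
      by (simp add: P_def)
    moreover have "l \<in> lists C"
      using h_C by (auto simp: l_def)
    ultimately obtain w where "w \<in> lists C" "P (Inl (b, p, x)) l w"
      using closed by blast
    then obtain g' where g': "g' \<in> C" "usat (A b) ((?env l)(x := g')) p"
      by (auto simp: P_def)
    obtain i where i: "eqv (h i) g'"
      using h_surj[OF g'(1)] by blast
    have "usat (A b) ((h \<circ> e)(x := h i)) p \<longleftrightarrow> usat (A b) ((?env l)(x := g')) p"
      by (rule usat_cong) (use i l in \<open>auto simp: eqv_def\<close>)
    then show ?thesis using g'(2) by blast
  qed
  have upd: "h \<circ> e(x := i) = (h \<circ> e)(x := h i)" for e x i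
    by auto
  have sat_S: "sat (S b) e p \<longleftrightarrow> usat (A b) (h \<circ> e) p" if "wf_fm \<tau> p" for b e p
    using that
  proof (induction p arbitrary: e)
    case (Eq x y)
    then show ?case using h_inj by (simp add: usat_def eqv_def)
  next
    case (Rel R xs)
    then show ?case by (simp add: usat_def S_def atoms_def o_def)
  next
    case (Ex x p)
    then show ?case
      unfolding usat_Ex sat.simps wf_fm.simps upd using Ex_C by (simp only: upd) blast
  next
    case (All x p)
    have "usat (A b) ((h \<circ> e)(x := g)) p" if "\<And>i. usat (A b) ((h \<circ> e)(x := h i)) p" for g
      using that Ex_C[of b e x g "Neg p"] unfolding usat_Neg by blast
    then show ?case
      using All unfolding usat_All sat.simps wf_fm.simps upd by (simp only: upd) blast
  qed (simp_all add: usat_Neg usat_Conj usat_Disj usat_Imp)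
  show thesis
  proof
    show "S b \<in> topspace (ModSpace \<tau>)" for b
      by (auto simp: topspace_ModSpace S_def PiE_iff extensional_def)
  next
    fix b p assume p: "sentence \<tau> p"
    have "usat (A b) (h \<circ> e) p \<longleftrightarrow> usat (A b) (\<lambda>v n. e v) p"
      by (rule usat_cong_eq) (use p in \<open>simp add: sentence_def\<close>)
    then show "sat (S b) e p \<longleftrightarrow> eventually (\<lambda>n. sat (A b n) e p) F"
      using sat_S p by (simp add: sentence_def usat_def)
  next
    fix b b' k l l' assume le: "type_le \<tau> (Suc k) (S b) l (S b') l'"
    have env_h: "?env (map h l) v = h (env 0 l v)" if "v < length l" for l v
      using that by (simp add: env_def)
    have ule_iff: "type_le \<tau> k (S b) l (S b') l' \<longleftrightarrow> length l \<le> length l' \<and>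
        ule \<tau> k (length l) (A b) (?env (map h l)) (A b') (?env (map h l'))" for k b l b' l'
    proof (cases "length l \<le> length l'")
      case True
      have "ule \<tau> k (length l) (A b) (?env (map h l)) (A b') (?env (map h l')) \<longleftrightarrow>
          ule \<tau> k (length l) (A b) (h \<circ> env 0 l) (A b') (h \<circ> env 0 l')"
        by (rule ule_cong) (use True env_h in auto)
      also have "\<dots> \<longleftrightarrow> type_le \<tau> k (S b) l (S b') l'"
        unfolding ule_def type_le_def using True sat_S by blast
      finally show ?thesis using True by blast
    qed (simp add: type_le_def)
    have len: "length l \<le> length l'"
      using le by (simp add: type_le_def)
    obtain e'' where e'': "\<forall>v<length l. e'' v = ?env (map h l) v"
        "ule \<tau> k (length l') (A b') (?env (map h l')) (A b) e''"
      using le ule_back_and_forth len unfolding ule_iff by blast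
    define w where "w = map e'' [length l..<length l']"
    have w: "length (map h l @ w) = length l'"
      using len by (simp add: w_def)
    have "?env (map h l @ w) v = e'' v" if "v < length l'" for v
      using that e''(1) w by (auto simp: env_def nth_append w_def)
    then have "ule \<tau> k (length l') (A b') (?env (map h l')) (A b) (?env (map h l @ w))"
      using e''(2) by (subst ule_cong[where d = "?env (map h l')" and d' = e'']) auto
    then have "P (Inr (b, b', k, length l)) (map h l @ map h l') w"
      using w by (simp add: P_def)
    moreover have "map h l @ map h l' \<in> lists C"
      using h_C by auto
    ultimately obtain w' where w': "w' \<in> lists C" "P (Inr (b, b', k, length l)) (map h l @ map h l') w'"
      using closed by blast
    \<comment> \<open>The witnesses are sequences in \<open>C\<close>; each is replaced by the
      number that names its class.\<close>
    have "\<exists>m. length m = length w' \<and> (\<forall>i<length w'. eqv (h (m ! i)) (w' ! i))"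
    proof -
      obtain c where c: "\<And>g. g \<in> C \<Longrightarrow> eqv (h (c g)) g"
        using h_surj by metis
      show ?thesis
        using w'(1) c by (intro exI[of _ "map c w'"]) (auto simp: in_lists_conv_set)
    qed
    then obtain m where m: "length m = length w'" "\<And>i. i < length w' \<Longrightarrow> eqv (h (m ! i)) (w' ! i)"
      by blast
    have "ule \<tau> k (length l') (A b') (?env (map h l')) (A b) (?env (map h l @ w'))"
      and len': "length (l @ m) = length l'"
      using w'(2) m(1) by (simp_all add: P_def)
    then have "ule \<tau> k (length l') (A b') (?env (map h l')) (A b) (?env (map h (l @ m)))"
    proof (subst ule_cong[where d = "?env (map h l')" and d' = "?env (map h l @ w')"])
      fix v assume "v < length l'"
      then show "eventually (\<lambda>n. ?env (map h (l @ m)) v n = ?env (map h l @ w') v n) F"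
        using m len' by (auto simp: env_def nth_append eqv_def)
    qed auto
    then have "type_le \<tau> k (S b') l' (S b) (l @ m)"
      unfolding ule_iff using len' by simp
    then show "\<exists>m. length (l @ m) = length l' \<and> type_le \<tau> k (S b') l' (S b) (l @ m)"
      using len' by blast
  qed
qed

end

subsection \<open>True stages\<close>

text \<open>\<open>B s i\<close> reads ``by stage \<open>s\<close> the \<open>i\<close>-th fact has been observed''. The rank of a stage is the least fact
  newly observed there (capped by the stage itself, so that stage \<open>0\<close> has rank \<open>0\<close> at every level).
  A stage is true at level \<open>k + 1\<close> as long as no later stage true at level \<open>k\<close> has smaller rank;
  facts of level \<open>k + 1\<close> are existential statements about the non-occurrence of facts of level \<open>k\<close>.\<close>

definition least_new_fact :: "(nat \<Rightarrow> nat \<Rightarrow> bool) \<Rightarrow> (nat \<Rightarrow> nat \<Rightarrow> bool) \<Rightarrow> nat \<Rightarrow> nat" where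
  "least_new_fact le B s = (LEAST i. i = s \<or> B s i \<and> (\<forall>r<s. le r s \<longrightarrow> \<not> B r i))"

primrec stages :: "(nat \<Rightarrow> nat \<Rightarrow> bool) \<Rightarrow> nat \<Rightarrow> (nat \<Rightarrow> nat \<Rightarrow> bool) \<times> (nat \<Rightarrow> nat \<Rightarrow> bool)" where
  "stages B 0 = ((\<le>), B)"
| "stages B (Suc k) =
     (\<lambda>s t. fst (stages B k) s t \<and> (\<forall>r. s < r \<and> fst (stages B k) s r \<and> fst (stages B k) r t \<longrightarrow>
        least_new_fact (fst (stages B k)) (snd (stages B k)) s \<le> least_new_fact (fst (stages B k)) (snd (stages B k)) r),
      \<lambda>s i. \<exists>j. prod_encode (i, j) < least_new_fact (fst (stages B k)) (snd (stages B k)) s \<and>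
        (\<forall>r. fst (stages B k) r s \<longrightarrow> \<not> snd (stages B k) r (prod_encode (i, j))))"

definition stage_le :: "(nat \<Rightarrow> nat \<Rightarrow> bool) \<Rightarrow> nat \<Rightarrow> nat \<Rightarrow> nat \<Rightarrow> bool" where
  "stage_le B k = fst (stages B k)"

definition fact_at :: "(nat \<Rightarrow> nat \<Rightarrow> bool) \<Rightarrow> nat \<Rightarrow> nat \<Rightarrow> nat \<Rightarrow> bool" where
  "fact_at B k = snd (stages B k)"

definition stage_rank :: "(nat \<Rightarrow> nat \<Rightarrow> bool) \<Rightarrow> nat \<Rightarrow> nat \<Rightarrow> nat" where
  "stage_rank B k = least_new_fact (stage_le B k) (fact_at B k)"

lemma stage_le_0: "stage_le B 0 s t \<longleftrightarrow> s \<le> t"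
  by (simp add: stage_le_def)

lemma fact_at_0: "fact_at B 0 = B"
  by (simp add: fact_at_def)

lemma stage_le_Suc: "stage_le B (Suc k) s t \<longleftrightarrow> stage_le B k s t \<and>
    (\<forall>r. s < r \<and> stage_le B k s r \<and> stage_le B k r t \<longrightarrow> stage_rank B k s \<le> stage_rank B k r)"
  by (simp add: stage_le_def stage_rank_def fact_at_def)

lemma fact_at_Suc: "fact_at B (Suc k) s i \<longleftrightarrow> (\<exists>j. prod_encode (i, j) < stage_rank B k s \<and>
    (\<forall>r. stage_le B k r s \<longrightarrow> \<not> fact_at B k r (prod_encode (i, j))))"
  by (simp add: stage_le_def stage_rank_def fact_at_def)

lemma stage_le_imp_le: "stage_le B k s t \<Longrightarrow> s \<le> t"
  by (induction k) (auto simp: stage_le_0 stage_le_Suc)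

lemma stage_le_refl: "stage_le B k s s"
  by (induction k) (auto simp: stage_le_0 stage_le_Suc dest: stage_le_imp_le)

text \<open>The predecessors of a stage form a chain, and the relation is transitive. The inductive
  proof of each property uses the other, hence the conjunction.\<close>

lemma stage_le_tree_trans:
  "(stage_le B k r t \<longrightarrow> stage_le B k s t \<longrightarrow> r \<le> s \<longrightarrow> stage_le B k r s) \<and>
   (stage_le B k r s \<longrightarrow> stage_le B k s t \<longrightarrow> stage_le B k r t)"
proof (induction k arbitrary: r s t)
  case 0
  then show ?case by (auto simp: stage_le_0)
next
  case (Suc k)
  note tree = Suc.IH[THEN conjunct1, rule_format] and trans = Suc.IH[THEN conjunct2, rule_format]
  have D: "stage_le B k u v" if "stage_le B (Suc k) u v" for u v
    using that unfolding stage_le_Suc by (rule conjunct1)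
  have R: "stage_rank B k u \<le> stage_rank B k w"
    if "stage_le B (Suc k) u v" "u < w" "stage_le B k u w" "stage_le B k w v" for u v w
    using that unfolding stage_le_Suc by blast
  show ?case
  proof (intro conjI impI)
    assume rt: "stage_le B (Suc k) r t" and st: "stage_le B (Suc k) s t" and rs: "r \<le> s"
    have "stage_le B k r s"
      by (rule tree[OF D[OF rt] D[OF st] rs])
    moreover have "stage_rank B k r \<le> stage_rank B k u" if "r < u" "stage_le B k r u" "stage_le B k u s" for u
      by (rule R[OF rt that(1,2) trans[OF that(3) D[OF st]]])
    ultimately show "stage_le B (Suc k) r s"
      unfolding stage_le_Suc by blast
  next
    assume rs: "stage_le B (Suc k) r s" and st: "stage_le B (Suc k) s t"
    have "stage_le B k r t"
      by (rule trans[OF D[OF rs] D[OF st]])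
    moreover have "stage_rank B k r \<le> stage_rank B k u" if u: "r < u" "stage_le B k r u" "stage_le B k u t" for u
    proof (cases "u \<le> s")
      case True
      show ?thesis
        by (rule R[OF rs u(1,2) tree[OF u(3) D[OF st] True]])
    next
      case False
      then have su: "stage_le B k s u"
        using tree[OF D[OF st] u(3)] by simp
      then have "stage_rank B k s \<le> stage_rank B k u"
        using R[OF st _ su u(3)] False by simp
      moreover have "stage_rank B k r \<le> stage_rank B k s"
        using R[OF rs _ D[OF rs] stage_le_refl] stage_le_imp_le[OF rs] by (cases "r = s") auto
      ultimately show ?thesis by simp
    qed
    ultimately show "stage_le B (Suc k) r t"
      unfolding stage_le_Suc by blast
  qed
qed

lemmas stage_le_tree = stage_le_tree_trans[THEN conjunct1, rule_format]
lemmas stage_le_trans = stage_le_tree_trans[THEN conjunct2, rule_format]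

lemma stage_le_SucD: "stage_le B (Suc k) s t \<Longrightarrow> stage_le B k s t"
  by (simp add: stage_le_Suc)

text \<open>A tree property across levels: \<open>s\<close> has to lie below \<open>t\<close> only
  at level \<open>k\<close>. It links the last predecessors of a stage at successive levels into the
  chain required by \<open>next_tuple\<close>.\<close>

lemma stage_le_Suc_tree:
  assumes "stage_le B (Suc k) r t" "stage_le B k s t" "r \<le> s"
  shows "stage_le B (Suc k) r s"
proof -
  have "stage_le B k r s"
    using assms stage_le_tree stage_le_SucD by blast
  then show ?thesis
    using assms stage_le_trans unfolding stage_le_Suc by blast
qed

lemma stage_rank_le: "stage_rank B k s \<le> s"
  unfolding stage_rank_def least_new_fact_def by (rule Least_le) simp

text \<open>Ensures that every later stage has a predecessor at each level; the cap on ranks gives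
  stage \<open>0\<close> rank \<open>0\<close>.\<close>

lemma stage_0_le: "stage_le B k 0 t"
proof (induction k)
  case (Suc k)
  then show ?case
    using stage_rank_le[of B k 0] by (auto simp: stage_le_Suc)
qed (simp add: stage_le_0)

lemma stage_rank_le_new:
  "fact_at B k s i \<Longrightarrow> (\<And>r. r < s \<Longrightarrow> stage_le B k r s \<Longrightarrow> \<not> fact_at B k r i) \<Longrightarrow> stage_rank B k s \<le> i"
  unfolding stage_rank_def least_new_fact_def by (rule Least_le) blast

lemma stage_rank_cases:
  "stage_rank B k s = s \<or> fact_at B k s (stage_rank B k s) \<and>
     (\<forall>r<s. stage_le B k r s \<longrightarrow> \<not> fact_at B k r (stage_rank B k s))"
  unfolding stage_rank_def least_new_fact_def by (rule LeastI[of _ s]) simp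

text \<open>The witness for a fact has a code below the rank of \<open>s\<close>, and stages on the
  way to \<open>t\<close> have at least that rank, so none of them can newly observe the
  code.\<close>

lemma fact_at_persistent:
  assumes "\<And>s t i. s \<le> t \<Longrightarrow> B s i \<Longrightarrow> B t i"
    and le: "stage_le B k s t" and fact: "fact_at B k s i"
  shows "fact_at B k t i"
proof (cases k)
  case 0
  then show ?thesis using assms by (auto simp: stage_le_0 fact_at_0)
next
  case (Suc m)
  then obtain j where j: "prod_encode (i, j) < stage_rank B m s"
      "\<And>r. stage_le B m r s \<Longrightarrow> \<not> fact_at B m r (prod_encode (i, j))"
    using fact by (auto simp: fact_at_Suc)
  have le': "stage_le B m s t" "\<And>r. s < r \<Longrightarrow> stage_le B m s r \<Longrightarrow> stage_le B m r t \<Longrightarrow> stage_rank B m s \<le> stage_rank B m r"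
    using le Suc by (auto simp: stage_le_Suc)
  have "\<not> fact_at B m r (prod_encode (i, j))" if "stage_le B m r t" for r
    using that
  proof (induction r rule: less_induct)
    case (less r)
    show ?case
    proof (cases "r \<le> s")
      case True
      then show ?thesis using j(2) stage_le_tree[OF less.prems le'(1)] by blast
    next
      case False
      then have "stage_le B m s r"
        using stage_le_tree[OF le'(1) less.prems] by simp
      then have "stage_rank B m s \<le> stage_rank B m r"
        using le'(2) False less.prems by simp
      \<comment> \<open>A code below the rank is not new at \<open>r\<close>, and by induction it
        was not observed before \<open>r\<close> either.\<close>
      then have "\<not> stage_rank B m r \<le> prod_encode (i, j)"
        using j(1) by simp
      then show ?thesis
        using stage_rank_le_new[of B m r] less.IH stage_le_trans[OF _ less.prems] by blast
    qed
  qed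
  moreover have "stage_rank B m s \<le> stage_rank B m t"
  proof (cases "s = t")
    case False
    then show ?thesis
      using le' stage_le_imp_le[OF le'(1)] stage_le_refl by (auto simp: le_less)
  qed simp
  ultimately show ?thesis
    using j(1) unfolding Suc fact_at_Suc by (intro exI[of _ j]) auto
qed

text \<open>Everything up to stage \<open>s\<close> depends only on \<open>B\<close> up to
  \<open>s\<close>; this makes a construction from finite prefixes possible.\<close>

lemma stages_cong:
  assumes "\<And>r. r \<le> s \<Longrightarrow> B r = B' r"
  shows "t \<le> s \<Longrightarrow> stage_le B k r t = stage_le B' k r t" "t \<le> s \<Longrightarrow> fact_at B k t = fact_at B' k t"
proof -
  have "\<forall>t\<le>s. (\<forall>r. stage_le B k r t = stage_le B' k r t) \<and> fact_at B k t = fact_at B' k t"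
  proof (induction k)
    case 0
    then show ?case using assms by (simp add: stage_le_0 fact_at_0)
  next
    case (Suc k)
    then have le: "\<And>r t. t \<le> s \<Longrightarrow> stage_le B k r t = stage_le B' k r t"
        and fact: "\<And>t. t \<le> s \<Longrightarrow> fact_at B k t = fact_at B' k t"
      by auto
    have rank: "stage_rank B k t = stage_rank B' k t" if "t \<le> s" for t
    proof -
      have "(\<forall>r<t. stage_le B k r t \<longrightarrow> \<not> fact_at B k r i) \<longleftrightarrow> (\<forall>r<t. stage_le B' k r t \<longrightarrow> \<not> fact_at B' k r i)" for i
        using le[OF that] fact that by auto
      then show ?thesis
        using fact[OF that] by (simp add: stage_rank_def least_new_fact_def)
    qed
    show ?case
    proof (intro allI impI conjI ext)
      fix t r assume t: "t \<le> s"
      have u: "u \<le> s" if "stage_le B' k u t" for u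
        using stage_le_imp_le[OF that] t by simp
      have "(r < u \<and> stage_le B k r u \<and> stage_le B' k u t \<longrightarrow> stage_rank B k r \<le> stage_rank B k u) \<longleftrightarrow>
          (r < u \<and> stage_le B' k r u \<and> stage_le B' k u t \<longrightarrow> stage_rank B' k r \<le> stage_rank B' k u)"
        if "stage_le B' k r t" for u
        using le[of u r] rank[of u] rank[of r] u[of u] u[of r] that by auto
      then show "stage_le B (Suc k) r t = stage_le B' (Suc k) r t"
        unfolding stage_le_Suc le[OF t] by blast
      fix i
      have "(stage_le B' k r t \<longrightarrow> \<not> fact_at B k r m) \<longleftrightarrow> (stage_le B' k r t \<longrightarrow> \<not> fact_at B' k r m)" for r m
        using u[of r] fact[of r] by auto
      then show "fact_at B (Suc k) t i = fact_at B' (Suc k) t i"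
        unfolding fact_at_Suc le[OF t] rank[OF t] by blast
    qed
  qed
  then show "t \<le> s \<Longrightarrow> stage_le B k r t = stage_le B' k r t" "t \<le> s \<Longrightarrow> fact_at B k t = fact_at B' k t"
    by auto
qed

section \<open>The infinite path of true stages\<close>

text \<open>The condition in \<open>stage_le_Suc\<close> with its right end moved to
  infinity.\<close>

primrec true_stages :: "(nat \<Rightarrow> nat \<Rightarrow> bool) \<Rightarrow> nat \<Rightarrow> nat set" where
  "true_stages B 0 = UNIV"
| "true_stages B (Suc k) =
     {s \<in> true_stages B k. \<forall>r\<in>true_stages B k. s < r \<longrightarrow> stage_rank B k s \<le> stage_rank B k r}"

text \<open>Beyond any bound, a stage of least rank among those true at level \<open>k\<close> is
  true at level \<open>k + 1\<close>.\<close>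

lemma infinite_true_stages: "infinite (true_stages B k)"
proof (induction k)
  case (Suc k)
  show ?case
    unfolding infinite_nat_iff_unbounded
  proof
    fix m
    have "\<exists>s. s \<in> true_stages B k \<and> m < s"
      using Suc unfolding infinite_nat_iff_unbounded by blast
    then obtain s where s: "s \<in> true_stages B k \<and> m < s"
        "\<And>r. r \<in> true_stages B k \<and> m < r \<Longrightarrow> stage_rank B k s \<le> stage_rank B k r"
      using ex_has_least_nat[of "\<lambda>s. s \<in> true_stages B k \<and> m < s" _ "stage_rank B k"] by blast
    then have "s \<in> true_stages B (Suc k)"
      by auto
    then show "\<exists>n>m. n \<in> true_stages B (Suc k)"
      using s(1) by blast
  qed
qed simp

text \<open>Together with infinitude: the true stages of level \<open>k\<close> are an infinite
  branch of the tree \<open>stage_le B k\<close>.\<close>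

lemma true_stages_downward:
  "stage_le B k r t \<Longrightarrow> t \<in> true_stages B k \<Longrightarrow> r \<in> true_stages B k"
  and true_stages_chain:
  "s \<in> true_stages B k \<Longrightarrow> t \<in> true_stages B k \<Longrightarrow> s \<le> t \<Longrightarrow> stage_le B k s t"
proof -
  have "(\<forall>r t. stage_le B k r t \<longrightarrow> t \<in> true_stages B k \<longrightarrow> r \<in> true_stages B k) \<and>
     (\<forall>s t. s \<in> true_stages B k \<longrightarrow> t \<in> true_stages B k \<longrightarrow> s \<le> t \<longrightarrow> stage_le B k s t)"
  proof (induction k)
    case 0
    then show ?case by (simp add: stage_le_0)
  next
    case (Suc k)
    then have down: "\<And>r t. stage_le B k r t \<Longrightarrow> t \<in> true_stages B k \<Longrightarrow> r \<in> true_stages B k"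
      and chain: "\<And>s t. s \<in> true_stages B k \<Longrightarrow> t \<in> true_stages B k \<Longrightarrow> s \<le> t \<Longrightarrow> stage_le B k s t"
      by blast+
    show ?case
    proof (intro conjI allI impI)
      fix r t assume rt: "stage_le B (Suc k) r t" and t: "t \<in> true_stages B (Suc k)"
      have r: "r \<in> true_stages B k"
        using down rt t by (auto simp: stage_le_Suc)
      have rank: "stage_rank B k r \<le> stage_rank B k t"
      proof (cases "r = t")
        case False
        then have "r < t" using stage_le_imp_le[OF rt] by simp
        then show ?thesis using rt stage_le_refl by (auto simp: stage_le_Suc)
      qed simp
      have "stage_rank B k r \<le> stage_rank B k u" if u: "u \<in> true_stages B k" "r < u" for u
      proof (cases "u \<le> t")
        case True
        then show ?thesis
          using rt u t chain r by (auto simp: stage_le_Suc)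
      next
        case False
        then have "stage_rank B k t \<le> stage_rank B k u"
          using t u by auto
        then show ?thesis using rank by simp
      qed
      then show "r \<in> true_stages B (Suc k)"
        using r by simp
    next
      fix s t assume s: "s \<in> true_stages B (Suc k)" and t: "t \<in> true_stages B (Suc k)" and st: "s \<le> t"
      have sk: "s \<in> true_stages B k" and tk: "t \<in> true_stages B k"
        using s t by simp_all
      have "stage_rank B k s \<le> stage_rank B k r" if "s < r" "stage_le B k r t" for r
        using down[OF that(2) tk] that(1) s by simp
      then show "stage_le B (Suc k) s t"
        using chain[OF sk tk st] unfolding stage_le_Suc by blast
    qed
  qed
  then show "stage_le B k r t \<Longrightarrow> t \<in> true_stages B k \<Longrightarrow> r \<in> true_stages B k"
    "s \<in> true_stages B k \<Longrightarrow> t \<in> true_stages B k \<Longrightarrow> s \<le> t \<Longrightarrow> stage_le B k s t"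
    by blast+
qed

text \<open>Once the cap is not attained, the rank is a newly observed fact. A fact is new only once
  along the path, so ranks do not repeat and cannot stay bounded.\<close>

lemma stage_rank_unbounded: "\<exists>s\<in>true_stages B (Suc k). m < stage_rank B k s"
proof (rule ccontr)
  let ?T = "true_stages B (Suc k)"
  assume "\<not> (\<exists>s\<in>?T. m < stage_rank B k s)"
  then have "stage_rank B k ` {s \<in> ?T. m < s} \<subseteq> {..m}"
    by (auto simp: not_less)
  then have fin: "finite (stage_rank B k ` {s \<in> ?T. m < s})"
    by (rule finite_subset) simp
  have "inj_on (stage_rank B k) {s \<in> ?T. m < s}"
  proof (rule linorder_inj_onI')
    fix s t assume st: "s \<in> {s \<in> ?T. m < s}" "t \<in> {s \<in> ?T. m < s}" "s < t"
    have "stage_rank B k s \<le> m" "stage_rank B k t \<le> m"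
      using \<open>\<not> (\<exists>s\<in>?T. m < stage_rank B k s)\<close> st by (auto simp: not_less)
    then have "fact_at B k s (stage_rank B k s)"
        "\<And>r. r < t \<Longrightarrow> stage_le B k r t \<Longrightarrow> \<not> fact_at B k r (stage_rank B k t)"
      using stage_rank_cases[of B k s] stage_rank_cases[of B k t] st by auto
    moreover have "stage_le B k s t"
      using true_stages_chain[of s B k t] st by auto
    ultimately show "stage_rank B k s \<noteq> stage_rank B k t"
      using st by metis
  qed
  then have "finite {s \<in> ?T. m < s}"
    using fin finite_imageD by blast
  moreover have "?T \<subseteq> {s \<in> ?T. m < s} \<union> {..m}"
    by auto
  ultimately have "finite ?T"
    using finite_subset by blast
  then show False using infinite_true_stages by blast
qed

text \<open>A true absence is recorded at a true stage whose rank exceeds its code. Conversely, an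
  absence recorded at a true stage is final, since later true stages have no smaller rank.\<close>

lemma fact_at_true_stage:
  assumes base: "\<And>i. V 0 i \<longleftrightarrow> (\<exists>s. B s i)"
    and step: "\<And>k i. V (Suc k) i \<longleftrightarrow> (\<exists>j. \<not> V k (prod_encode (i, j)))"
  shows "V k i \<longleftrightarrow> (\<exists>s\<in>true_stages B k. fact_at B k s i)"
proof (induction k arbitrary: i)
  case 0
  then show ?case by (simp add: base fact_at_0)
next
  case (Suc k)
  show ?case
  proof
    assume "V (Suc k) i"
    then obtain j where j: "\<not> V k (prod_encode (i, j))"
      using step by blast
    obtain s where s: "s \<in> true_stages B (Suc k)" "prod_encode (i, j) < stage_rank B k s"
      using stage_rank_unbounded by blast
    have "\<not> fact_at B k r (prod_encode (i, j))" if "stage_le B k r s" for r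
      using j Suc.IH true_stages_downward[OF that] s(1) by auto
    then show "\<exists>s\<in>true_stages B (Suc k). fact_at B (Suc k) s i"
      using s unfolding fact_at_Suc by blast
  next
    assume "\<exists>s\<in>true_stages B (Suc k). fact_at B (Suc k) s i"
    then obtain s j where s: "s \<in> true_stages B (Suc k)" "prod_encode (i, j) < stage_rank B k s"
        "\<And>r. stage_le B k r s \<Longrightarrow> \<not> fact_at B k r (prod_encode (i, j))"
      unfolding fact_at_Suc by blast
    have "\<not> fact_at B k r (prod_encode (i, j))" if "r \<in> true_stages B k" for r
      using that
    proof (induction r rule: less_induct)
      case (less r)
      show ?case
      proof (cases "r \<le> s")
        case True
        then show ?thesis using s(1,3) true_stages_chain[of r B k s] less.prems by auto
      next
        case False
        then have "\<not> stage_rank B k r \<le> prod_encode (i, j)"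
          using s(1,2) less.prems by auto
        then show ?thesis
          using stage_rank_le_new[of B k r] less.IH true_stages_downward[OF _ less.prems] by blast
      qed
    qed
    then show "V (Suc k) i"
      using Suc.IH step by blast
  qed
qed

text \<open>Whole families are coded at once: unfolding one level gives a family indexed by pairs,
  which \<open>prod_encode\<close> makes into a sequence again.\<close>

lemma bSigma_code:
  assumes "\<And>i. A i \<in> bSigma Cantor (Suc k)"
  shows "\<exists>W. (\<forall>i. openin Cantor (W 0 i)) \<and> (\<forall>j i x. x \<in> W (Suc j) i \<longleftrightarrow> (\<exists>l. x \<notin> W j (prod_encode (i, l)))) \<and> W k = A"
  using assms
proof (induction k arbitrary: A)
  case 0
  \<comment> \<open>Only level \<open>0\<close> is prescribed; the recursion fixes all higher
    levels.\<close>
  define W where "W = rec_nat A (\<lambda>j V i. {x. \<exists>l. x \<notin> V (prod_encode (i, l))})"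
  show ?case
    by (rule exI[of _ W]) (use 0 in \<open>auto simp: W_def\<close>)
next
  case (Suc k)
  have "\<forall>i. \<exists>B. A i = \<Union>(range B) \<and> (\<forall>j::nat. UNIV - B j \<in> bSigma Cantor (Suc k))"
    using Suc.prems by (auto simp: topspace_Cantor)
  then obtain B where B: "\<And>i. A i = (\<Union>j. B i j)" "\<And>i j::nat. UNIV - B i j \<in> bSigma Cantor (Suc k)"
    by metis
  define A' where "A' m = UNIV - B (fst (prod_decode m)) (snd (prod_decode m))" for m
  obtain W where W: "\<And>i. openin Cantor (W 0 i)"
      "\<And>j i x. x \<in> W (Suc j) i \<longleftrightarrow> (\<exists>l. x \<notin> W j (prod_encode (i, l)))" "W k = A'"
    using Suc.IH[of A'] B(2) unfolding A'_def by blast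
  have "W (Suc k) = A"
    by (rule ext) (auto simp: W(2,3) A'_def B(1))
  then show ?case using W(1,2) by blast
qed

subsection \<open>The construction along true stages\<close>

lemma type_le_append: "type_le \<tau> k M l M (l @ m)"
proof -
  have "sat M (env 0 l) p = sat M (env 0 (l @ m)) p" if "fv p \<subseteq> {..<length l}" for p
    by (rule sat_cong) (use that in \<open>auto simp: env_def nth_append\<close>)
  then show ?thesis
    by (simp add: type_le_def)
qed

lemma type_le_refl: "type_le \<tau> k M l M l"
  using type_le_append[of \<tau> k M l "[]"] by simp

lemma type_le_trans:
  assumes "type_le \<tau> k M l M' l'" "type_le \<tau> k M' l' M'' l''"
  shows "type_le \<tau> k M l M'' l''"
proof -
  have "fv p \<subseteq> {..<length l'}" if "fv p \<subseteq> {..<length l}" for p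
    using that assms(1) by (auto simp: type_le_def)
  then show ?thesis
    using assms unfolding type_le_def by (meson order_trans)
qed

lemma type_le_mono: "type_le \<tau> k M l M' l' \<Longrightarrow> j \<le> k \<Longrightarrow> type_le \<tau> j M l M' l'"
  unfolding type_le_def using univ_n_mono by blast

text \<open>Inclusion becomes agreement since the negation of a quantifier-free formula is again
  quantifier-free.\<close>

lemma type_le_qfree:
  assumes "type_le \<tau> k M l M' l'" "qfree p" "wf_fm \<tau> p" "fv p \<subseteq> {..<length l}"
  shows "sat M (env 0 l) p \<longleftrightarrow> sat M' (env 0 l') p"
proof -
  have "sat M' (env 0 l') q" if "qfree q" "wf_fm \<tau> q" "fv q \<subseteq> {..<length l}" "sat M (env 0 l) q" for q
    using assms(1) that qfree_univ_n[of q k] unfolding type_le_def by blast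
  from this[of p] this[of "Neg p"] show ?thesis
    using assms(2-4) by (simp only: qfree.simps wf_fm.simps fv.simps sat.simps) blast
qed

lemma type_le_distinct:
  assumes "type_le \<tau> k M l M' l'" "distinct l" "length l' = length l"
  shows "distinct l'"
  unfolding distinct_conv_nth
proof (intro allI impI)
  fix i j assume ij: "i < length l'" "j < length l'" "i \<noteq> j"
  then have "sat M (env 0 l) (Eq i j) \<longleftrightarrow> sat M' (env 0 l') (Eq i j)"
    using assms by (intro type_le_qfree) auto
  then show "l' ! i \<noteq> l' ! j"
    using ij assms(2,3) by (simp add: env_def nth_eq_iff_index_eq)
qed

lemma type_le_atom:
  assumes "type_le \<tau> k M l M' l'" "(R, as) \<in> atoms \<tau>" "set as \<subseteq> {..<length l}"
  shows "M (R, map (env 0 l) as) = M' (R, map (env 0 l') as)"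
proof -
  have "sat M (env 0 l) (Rel R as) \<longleftrightarrow> sat M' (env 0 l') (Rel R as)"
    using assms by (intro type_le_qfree) (auto simp: atoms_def)
  then show ?thesis by simp
qed

lemma sat_iso:
  assumes "bij h" "\<And>R as. (R, as) \<in> atoms \<tau> \<Longrightarrow> G (R, as) = M (R, map h as)" "wf_fm \<tau> p"
  shows "sat G e p \<longleftrightarrow> sat M (h \<circ> e) p"
  using assms(3)
proof (induction p arbitrary: e)
  case (Eq x y)
  then show ?case using assms(1) by (simp add: bij_def inj_eq)
next
  case (Rel R xs)
  then show ?case by (simp add: atoms_def assms(2) o_def)
next
  case (Ex x p)
  have "(\<exists>a. sat M (h \<circ> e(x := a)) p) \<longleftrightarrow> (\<exists>a. sat M ((h \<circ> e)(x := a)) p)"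
    unfolding fun_upd_comp using assms(1) by (metis bij_pointE)
  with Ex show ?case by (simp only: sat.simps wf_fm.simps)
next
  case (All x p)
  have "(\<forall>a. sat M (h \<circ> e(x := a)) p) \<longleftrightarrow> (\<forall>a. sat M ((h \<circ> e)(x := a)) p)"
    unfolding fun_upd_comp using assms(1) by (metis bij_pointE)
  with All show ?case by (simp only: sat.simps wf_fm.simps)
qed simp_all

section \<open>Ash's construction from a back-and-forth pair\<close>

text \<open>\<open>True\<close> is the side of the model of the theory, to be built when
  \<open>x\<close> lies in the set. \<open>start\<close> permits one change of side, from
  \<open>False\<close> to \<open>True\<close>.\<close>

locale back_and_forth_pair =
  fixes \<tau> :: vocab and S :: "bool \<Rightarrow> nat \<times> nat list \<Rightarrow> bool" and K :: nat
  assumes back_and_forth: "type_le \<tau> (Suc k) (S b) l (S b') l' \<Longrightarrow>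
      \<exists>m. length (l @ m) = length l' \<and> type_le \<tau> k (S b') l' (S b) (l @ m)"
    and start: "type_le \<tau> (Suc K) (S True) [] (S False) []"
begin

abbreviation LE :: "nat \<Rightarrow> bool \<times> nat list \<Rightarrow> bool \<times> nat list \<Rightarrow> bool" where
  "LE k p q \<equiv> type_le \<tau> k (S (fst p)) (snd p) (S (fst q)) (snd q)"

text \<open>Climbing from \<open>p 0\<close> to \<open>p K\<close>, each step spends one level to
  answer the tuple found so far by an extension of the next one. At most level \<open>j\<close> is
  demanded of that tuple, so what was achieved at lower levels survives.\<close>

lemma back_and_forth_chain:
  assumes "\<And>k. k < K \<Longrightarrow> LE (Suc k) (p (Suc k)) (p k)" "distinct (snd (p 0))" "j \<le> K"
  shows "\<exists>m. distinct (snd (p j) @ m) \<and> (\<forall>k\<le>j. LE k (p k) (fst (p j), snd (p j) @ m))"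
  using assms(3)
proof (induction j)
  case 0
  then show ?case using assms(2) type_le_refl by (intro exI[of _ "[]"]) simp
next
  case (Suc j)
  then obtain m where m: "distinct (snd (p j) @ m)" "\<And>k. k \<le> j \<Longrightarrow> LE k (p k) (fst (p j), snd (p j) @ m)"
    by auto
  have "LE (Suc j) (p (Suc j)) (fst (p j), snd (p j) @ m)"
    using type_le_trans[OF assms(1)[of j] type_le_append] Suc.prems by simp
  then obtain m' where m': "length (snd (p (Suc j)) @ m') = length (snd (p j) @ m)"
      "type_le \<tau> j (S (fst (p j))) (snd (p j) @ m) (S (fst (p (Suc j)))) (snd (p (Suc j)) @ m')"
    using back_and_forth by fastforce
  have "LE k (p k) (fst (p (Suc j)), snd (p (Suc j)) @ m')" if "k \<le> Suc j" for k
  proof (cases "k = Suc j")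
    case True
    then show ?thesis by (simp add: type_le_append)
  next
    case False
    then have "k \<le> j" using that by simp
    then show ?thesis
      using type_le_trans[OF _ type_le_mono[OF m'(2)]] m(2) by simp
  qed
  moreover have "distinct (snd (p (Suc j)) @ m')"
    using type_le_distinct[OF m'(2) m(1) m'(1)] .
  ultimately show ?case by blast
qed

text \<open>If the side stays the same, the tuple of \<open>p K\<close> is really extended; on a
  change of side only the type relations up to level \<open>K\<close> survive.\<close>

lemma next_tuple:
  assumes "\<And>k. k < K \<Longrightarrow> LE (Suc k) (p (Suc k)) (p k)" "distinct (snd (p 0))" "fst (p K) \<Longrightarrow> b"
  shows "\<exists>q. fst q = b \<and> distinct (snd q) \<and> {..<s} \<subseteq> set (snd q) \<and> (\<forall>k\<le>K. LE k (p k) q) \<and>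
    (fst (p K) = b \<longrightarrow> (\<exists>m. snd q = snd (p K) @ m))"
proof -
  obtain m where m: "distinct (snd (p K) @ m)" "\<And>k. k \<le> K \<Longrightarrow> LE k (p k) (fst (p K), snd (p K) @ m)"
    using back_and_forth_chain[of p K] assms(1,2) by blast
  have "\<exists>l. distinct l \<and> (\<forall>k\<le>K. LE k (p k) (b, l)) \<and> (fst (p K) = b \<longrightarrow> (\<exists>m. l = snd (p K) @ m))"
  proof (cases "fst (p K) = b")
    case True
    then show ?thesis
      using m by (intro exI[of _ "snd (p K) @ m"]) auto
  next
    case False
    then have b: "b" "fst (p K) = False"
      using assms(3) by auto
    \<comment> \<open>Regarded as an extension of the empty tuple, the tuple in
      \<open>S False\<close> is answered as a whole by a tuple in \<open>S True\<close>.\<close>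
    have "type_le \<tau> (Suc K) (S True) [] (S False) (snd (p K) @ m)"
      using type_le_trans[OF start type_le_append[of _ _ _ "[]"]] by simp
    then obtain l where l: "length l = length (snd (p K) @ m)"
        "type_le \<tau> K (S False) (snd (p K) @ m) (S True) l"
      using back_and_forth by fastforce
    have "distinct l"
      using type_le_distinct[OF l(2) m(1) l(1)] .
    moreover have "LE k (p k) (b, l)" if "k \<le> K" for k
      using type_le_trans[OF m(2)[OF that]] type_le_mono[OF l(2) that] b by simp
    ultimately show ?thesis
      using False by blast
  qed
  then obtain l where l: "distinct l" "\<And>k. k \<le> K \<Longrightarrow> LE k (p k) (b, l)"
      "fst (p K) = b \<Longrightarrow> \<exists>m. l = snd (p K) @ m"
    by blast
  \<comment> \<open>Missing numbers below \<open>s\<close> are appended, which makes the limit map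
    surjective.\<close>
  define n where "n = filter (\<lambda>v. v \<notin> set l) [0..<s]"
  have "LE k (p k) (b, l @ n)" if "k \<le> K" for k
    using type_le_trans[OF l(2)[OF that]] type_le_append by simp
  moreover have "distinct (l @ n)" "{..<s} \<subseteq> set (l @ n)"
    using l(1) by (auto simp: n_def)
  moreover have "\<exists>m. l @ n = snd (p K) @ m" if "fst (p K) = b"
    using l(3)[OF that] by auto
  ultimately show ?thesis
    by (intro exI[of _ "(b, l @ n)"]) simp
qed

text \<open>The first component of \<open>p s\<close> is the current guess about membership. Tuples
  must extend one another literally only along level \<open>K\<close> and on the same side;
  elsewhere inclusion of types suffices.\<close>

definition good_at :: "(nat \<Rightarrow> nat \<Rightarrow> bool) \<Rightarrow> (nat \<Rightarrow> bool \<times> nat list) \<Rightarrow> nat \<Rightarrow> bool" where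
  "good_at B p s \<longleftrightarrow> fst (p s) = fact_at B K s 0 \<and> distinct (snd (p s)) \<and> {..<s} \<subseteq> set (snd (p s)) \<and>
     (\<forall>k\<le>K. \<forall>r\<le>s. stage_le B k r s \<longrightarrow> LE k (p r) (p s)) \<and>
     (\<forall>r\<le>s. stage_le B K r s \<and> fst (p r) = fst (p s) \<longrightarrow> (\<exists>m. snd (p s) = snd (p r) @ m))"

lemma good_at_cong:
  assumes "\<And>r. r \<le> s \<Longrightarrow> B r = B' r" "\<And>r. r \<le> s \<Longrightarrow> p r = p' r"
  shows "good_at B p s \<longleftrightarrow> good_at B' p' s"
proof -
  have "stage_le B k r s = stage_le B' k r s" "fact_at B k s = fact_at B' k s" for k r
    using stages_cong[of s B B' s] assms(1) by auto
  moreover have "p s = p' s"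
    using assms(2) by simp
  ultimately show ?thesis
    unfolding good_at_def using assms(2) by simp
qed

text \<open>It is enough to respect, for each level \<open>k\<close>, the last predecessor
  \<open>\<sigma> k\<close>: by the tree property all others at that level lie below it.\<close>

lemma good_at_extend:
  assumes persistent: "\<And>s t i. s \<le> t \<Longrightarrow> B s i \<Longrightarrow> B t i"
    and good: "\<And>r. r < s \<Longrightarrow> good_at B p r"
  shows "\<exists>q. good_at B (p(s := q)) s"
proof (cases "s = 0")
  case True
  then show ?thesis
    by (intro exI[of _ "(fact_at B K 0 0, [])"]) (simp add: good_at_def type_le_refl)
next
  case False
  have persist: "fact_at B K t 0" if "stage_le B K r t" "fact_at B K r 0" for r t
    by (rule fact_at_persistent[OF _ that]) (rule persistent)
  define \<sigma> where "\<sigma> k = Max {r. r < s \<and> stage_le B k r s}" for k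
  have "finite {r. r < s \<and> stage_le B k r s}" for k
    by simp
  moreover have "0 \<in> {r. r < s \<and> stage_le B k r s}" for k
    using False stage_0_le by simp
  ultimately have \<sigma>: "\<sigma> k < s" "stage_le B k (\<sigma> k) s" and \<sigma>_max: "\<And>r. r < s \<Longrightarrow> stage_le B k r s \<Longrightarrow> r \<le> \<sigma> k" for k
    unfolding \<sigma>_def using Max_in[of "{r. r < s \<and> stage_le B k r s}"] Max_ge by blast+
  have fact: "fst (p r) = fact_at B K r 0" if "r < s" for r
    using good[OF that] by (simp add: good_at_def)
  have LE: "LE k (p r) (p t)" if "t < s" "k \<le> K" "stage_le B k r t" for k r t
    using good[OF that(1)] that(2,3) stage_le_imp_le[OF that(3)] unfolding good_at_def by blast
  have "\<exists>q. fst q = fact_at B K s 0 \<and> distinct (snd q) \<and> {..<s} \<subseteq> set (snd q) \<and> (\<forall>k\<le>K. LE k (p (\<sigma> k)) q) \<and>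
      (fst (p (\<sigma> K)) = fact_at B K s 0 \<longrightarrow> (\<exists>m. snd q = snd (p (\<sigma> K)) @ m))"
  proof (rule next_tuple[of "\<lambda>k. p (\<sigma> k)"])
    fix k assume "k < K"
    have "\<sigma> (Suc k) \<le> \<sigma> k"
      by (rule \<sigma>_max[OF \<sigma>(1) stage_le_SucD[OF \<sigma>(2)]])
    then have "stage_le B (Suc k) (\<sigma> (Suc k)) (\<sigma> k)"
      by (rule stage_le_Suc_tree[OF \<sigma>(2) \<sigma>(2)])
    then show "LE (Suc k) (p (\<sigma> (Suc k))) (p (\<sigma> k))"
      using \<open>k < K\<close> by (intro LE[OF \<sigma>(1)]) auto
  next
    show "distinct (snd (p (\<sigma> 0)))"
      using good[OF \<sigma>(1)] by (simp add: good_at_def)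
  next
    show "fact_at B K s 0" if "fst (p (\<sigma> K))"
      using that fact[OF \<sigma>(1)] persist[OF \<sigma>(2)] by simp
  qed
  then obtain q where q: "fst q = fact_at B K s 0" "distinct (snd q)" "{..<s} \<subseteq> set (snd q)"
      "\<And>k. k \<le> K \<Longrightarrow> LE k (p (\<sigma> k)) q"
      "fst (p (\<sigma> K)) = fact_at B K s 0 \<Longrightarrow> \<exists>m. snd q = snd (p (\<sigma> K)) @ m"
    by blast
  have tree: "stage_le B k r (\<sigma> k)" if "r < s" "stage_le B k r s" for k r
    using stage_le_tree[OF that(2) \<sigma>(2) \<sigma>_max[OF that]] .
  have 1: "LE k (p r) q" if "k \<le> K" "r < s" "stage_le B k r s" for k r
    using type_le_trans[OF LE[OF \<sigma>(1) that(1) tree[OF that(2,3)]] q(4)[OF that(1)]] .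
  have 2: "\<exists>m. snd q = snd (p r) @ m" if r: "r < s" "stage_le B K r s" "fst (p r) = fst q" for r
  proof -
    \<comment> \<open>The guess is persistent along level \<open>K\<close>, so equal guesses at
      \<open>r\<close> and \<open>s\<close> leave no room for a different one at
      \<open>\<sigma> K\<close>.\<close>
    have "fst (p (\<sigma> K)) = fact_at B K s 0"
    proof (cases "fact_at B K s 0")
      case True
      then have "fact_at B K r 0"
        using r(3) q(1) fact[OF r(1)] by simp
      then have "fact_at B K (\<sigma> K) 0"
        using persist[OF tree[OF r(1,2)]] by blast
      then show ?thesis
        using True fact[OF \<sigma>(1)] by simp
    next
      case False
      then show ?thesis
        using fact[OF \<sigma>(1)] persist[OF \<sigma>(2)] by blast
    qed
    moreover from this have "\<exists>m. snd (p (\<sigma> K)) = snd (p r) @ m"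
      using good[OF \<sigma>(1)] tree[OF r(1,2)] stage_le_imp_le[OF tree[OF r(1,2)]] r(3) q(1)
      unfolding good_at_def by metis
    ultimately show ?thesis
      using q(5) by auto
  qed
  have "good_at B (p(s := q)) s"
    unfolding good_at_def using q(1,2,3) 1 2 type_le_refl by (auto simp: le_less)
  then show ?thesis by blast
qed

text \<open>At late true stages the side is constant and the tuples extend one another; their union
  is the bijection. Atoms may be read off at any stage, true or not, since level \<open>0\<close>
  relates all stages.\<close>

lemma good_at_limit:
  assumes persistent: "\<And>s t i. s \<le> t \<Longrightarrow> B s i \<Longrightarrow> B t i"
    and good: "\<And>s. good_at B p s"
    and \<beta>: "\<beta> \<longleftrightarrow> (\<exists>s\<in>true_stages B K. fact_at B K s 0)"
  shows "\<exists>h. bij h \<and> (\<forall>R as s. (R, as) \<in> atoms \<tau> \<longrightarrow> set as \<subseteq> {..<s} \<longrightarrow>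
    S (fst (p s)) (R, map (env 0 (snd (p s))) as) = S \<beta> (R, map h as))"
proof -
  let ?T = "true_stages B K"
  have persist: "fact_at B K t 0" if "stage_le B K r t" "fact_at B K r 0" for r t
    by (rule fact_at_persistent[OF _ that]) (rule persistent)
  have fact: "fst (p s) = fact_at B K s 0" and dist: "distinct (snd (p s))" and sub: "{..<s} \<subseteq> set (snd (p s))"
    and LE: "k \<le> K \<Longrightarrow> stage_le B k r s \<Longrightarrow> LE k (p r) (p s)"
    and ext: "stage_le B K r s \<Longrightarrow> fst (p r) = fst (p s) \<Longrightarrow> \<exists>m. snd (p s) = snd (p r) @ m" for r s k
    using good[of s] stage_le_imp_le[of B _ r s] unfolding good_at_def by blast+
  have len: "s \<le> length (snd (p s))" for s
    using card_mono[OF _ sub[of s]] distinct_card[OF dist[of s]] by simp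
  \<comment> \<open>A positive guess persists from its first true stage on; if
    \<open>\<beta>\<close> fails, no true stage guesses positively.\<close>
  obtain t\<^sub>0 where t\<^sub>0: "t\<^sub>0 \<in> ?T" "\<And>t. t \<in> ?T \<Longrightarrow> t\<^sub>0 \<le> t \<Longrightarrow> fst (p t) = \<beta>"
  proof (cases \<beta>)
    case True
    then obtain t\<^sub>0 where t\<^sub>0: "t\<^sub>0 \<in> ?T" "fact_at B K t\<^sub>0 0"
      using \<beta> by blast
    then have "fst (p t) = \<beta>" if "t \<in> ?T" "t\<^sub>0 \<le> t" for t
      using persist[OF true_stages_chain[OF t\<^sub>0(1) that]] True fact by simp
    then show ?thesis using that t\<^sub>0(1) by blast
  next
    case False
    obtain t\<^sub>0 where "t\<^sub>0 \<in> ?T"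
      using infinite_true_stages[of B K] by fastforce
    then show ?thesis using that False \<beta> fact by blast
  qed
  define T' where "T' = {t \<in> ?T. t\<^sub>0 \<le> t}"
  have T'_ex: "\<exists>t\<in>T'. i < t" for i
    using infinite_true_stages[of B K] unfolding infinite_nat_iff_unbounded T'_def
    by (metis (mono_tags, lifting) max_less_iff_conj mem_Collect_eq less_imp_le)
  have T'_ext: "\<exists>m. snd (p t') = snd (p t) @ m" if "t \<in> T'" "t' \<in> T'" "t \<le> t'" for t t'
    using that t\<^sub>0(2) true_stages_chain unfolding T'_def by (intro ext) auto
  have nth_eq: "snd (p t) ! i = snd (p t') ! i"
    if t: "t \<in> T'" "t' \<in> T'" and i: "i < length (snd (p t))" "i < length (snd (p t'))" for t t' i
  proof (cases "t \<le> t'")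
    case True
    then obtain m where "snd (p t') = snd (p t) @ m" using T'_ext t by blast
    then show ?thesis using i by (simp add: nth_append)
  next
    case False
    then obtain m where "snd (p t) = snd (p t') @ m" using T'_ext[of t' t] t by auto
    then show ?thesis using i by (simp add: nth_append)
  qed
  define \<theta> where "\<theta> i = (SOME t. t \<in> T' \<and> i < t)" for i
  have \<theta>: "\<theta> i \<in> T'" "i < \<theta> i" for i
    using someI_ex[of "\<lambda>t. t \<in> T' \<and> i < t"] T'_ex[of i] unfolding \<theta>_def by blast+
  define h where "h i = snd (p (\<theta> i)) ! i" for i
  have h: "h i = snd (p t) ! i" if "t \<in> T'" "i < length (snd (p t))" for t i
    unfolding h_def using \<theta>[of i] that len[of "\<theta> i"] by (intro nth_eq) auto
  have "inj h"
  proof (rule injI)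
    fix i j assume ij: "h i = h j"
    obtain t where t: "t \<in> T'" "max i j < t" using T'_ex by blast
    then have "i < length (snd (p t))" "j < length (snd (p t))"
      using len[of t] by auto
    then show "i = j"
      using h[OF t(1)] ij dist[of t] by (simp add: nth_eq_iff_index_eq)
  qed
  moreover have "surj h"
    unfolding surj_def
  proof
    fix a :: nat
    obtain t where t: "t \<in> T'" "a < t" using T'_ex by blast
    then have "a \<in> set (snd (p t))" using sub[of t] by auto
    then obtain i where "i < length (snd (p t))" "snd (p t) ! i = a"
      by (auto simp: in_set_conv_nth)
    then show "\<exists>i. a = h i" using h[OF t(1)] by metis
  qed
  moreover have "S (fst (p s)) (R, map (env 0 (snd (p s))) as) = S \<beta> (R, map h as)"
    if a: "(R, as) \<in> atoms \<tau>" "set as \<subseteq> {..<s}" for R as s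
  proof -
    obtain t where t: "t \<in> T'" "s < t" using T'_ex by blast
    have "LE 0 (p s) (p t)"
      using t(2) by (intro LE) (auto simp: stage_le_0)
    moreover have "set as \<subseteq> {..<length (snd (p s))}"
      using a(2) len[of s] by auto
    ultimately have "S (fst (p s)) (R, map (env 0 (snd (p s))) as) = S (fst (p t)) (R, map (env 0 (snd (p t))) as)"
      by (rule type_le_atom[OF _ a(1)])
    moreover have "map (env 0 (snd (p t))) as = map h as"
      using a(2) len[of t] t h[OF t(1)] by (auto simp: env_def)
    moreover have "fst (p t) = \<beta>"
      using t(1) t\<^sub>0(2) by (simp add: T'_def)
    ultimately show ?thesis by simp
  qed
  ultimately show ?thesis
    by (auto simp: bij_def intro!: exI[of _ h])
qed

text \<open>The choice at a stage depends only on the prefix of \<open>x\<close> read so far, which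
  will make the reduction continuous; hence the recursion over bit strings.\<close>

lemma good_at_uniform:
  fixes B :: "(nat \<Rightarrow> bool) \<Rightarrow> nat \<Rightarrow> nat \<Rightarrow> bool"
  assumes persistent: "\<And>x s t i. s \<le> t \<Longrightarrow> B x s i \<Longrightarrow> B x t i"
    and local: "\<And>x y s. (\<And>i. i < s \<Longrightarrow> x i = y i) \<Longrightarrow> B x s = B y s"
  shows "\<exists>f. \<forall>x s. good_at (B x) (\<lambda>r. f (map x [0..<r])) s"
proof -
  \<comment> \<open>By \<open>local\<close>, the padding with \<open>False\<close> is invisible up
    to stage \<open>length \<sigma>\<close>. Proper prefixes supply the earlier tuples through
    \<open>f\<close>, and \<open>q\<close> is the candidate for the last one.\<close>
  define P where "P f \<sigma> q \<longleftrightarrow> good_at (B (env False \<sigma>)) ((\<lambda>r. f (take r \<sigma>))(length \<sigma> := q)) (length \<sigma>)"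
    for f :: "bool list \<Rightarrow> bool \<times> nat list" and \<sigma> q
  have "\<exists>f. \<forall>\<sigma>. P f \<sigma> (f \<sigma>)"
  proof (rule dependent_wf_choice[of "Wellfounded.measure length"])
    fix f g :: "bool list \<Rightarrow> bool \<times> nat list" and \<sigma> q
    assume fg: "\<And>\<rho>. (\<rho>, \<sigma>) \<in> Wellfounded.measure length \<Longrightarrow> f \<rho> = g \<rho>"
    show "P f \<sigma> q = P g \<sigma> q"
      unfolding P_def by (rule good_at_cong) (auto intro!: fg)
  next
    fix \<sigma> and f :: "bool list \<Rightarrow> bool \<times> nat list"
    assume IH: "\<And>\<rho>. (\<rho>, \<sigma>) \<in> Wellfounded.measure length \<Longrightarrow> P f \<rho> (f \<rho>)"
    show "\<exists>q. P f \<sigma> q"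
      unfolding P_def
    proof (rule good_at_extend)
      fix r assume r: "r < length \<sigma>"
      have "P f (take r \<sigma>) (f (take r \<sigma>))"
        using r by (intro IH) simp
      then show "good_at (B (env False \<sigma>)) (\<lambda>r. f (take r \<sigma>)) r"
        unfolding P_def
      proof (subst (asm) good_at_cong)
        show "B (env False (take r \<sigma>)) r' = B (env False \<sigma>) r'" if "r' \<le> length (take r \<sigma>)" for r'
          using that by (intro local) (auto simp: env_def)
        show "((\<lambda>r'. f (take r' (take r \<sigma>)))(length (take r \<sigma>) := f (take r \<sigma>))) r' = f (take r' \<sigma>)"
          if "r' \<le> length (take r \<sigma>)" for r'
          using that r by (auto simp: min_def)
      qed (use r in \<open>simp add: min_def\<close>)
    qed (rule persistent)
  qed simp
  then obtain f where f: "\<And>\<sigma>. P f \<sigma> (f \<sigma>)" by blast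
  have "good_at (B x) (\<lambda>r. f (map x [0..<r])) s" for x s
  proof -
    let ?\<sigma> = "map x [0..<s]"
    have "good_at (B (env False ?\<sigma>)) ((\<lambda>r. f (take r ?\<sigma>))(s := f ?\<sigma>)) s"
      using f[of ?\<sigma>] by (simp add: P_def)
    then show ?thesis
    proof (subst (asm) good_at_cong)
      show "B (env False ?\<sigma>) r = B x r" if "r \<le> s" for r
        using that by (intro local) (auto simp: env_def)
      show "((\<lambda>r. f (take r ?\<sigma>))(s := f ?\<sigma>)) r = f (map x [0..<r])" if "r \<le> s" for r
        using that by (auto simp: take_map min_def)
    qed
  qed
  then show ?thesis by blast
qed

section \<open>The continuous reduction\<close>

lemma hard_Mod:
  assumes T: "\<forall>p\<in>T. sentence \<tau> p"
    and S: "S True \<in> Mod \<tau> T" "S False \<in> topspace (ModSpace \<tau>)" "S False \<notin> Mod \<tau> T"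
  shows "hard (bSigma Cantor (Suc K)) (ModSpace \<tau>) (Mod \<tau> T)"
  unfolding hard_def
proof
  fix A assume A: "A \<in> bSigma Cantor (Suc K)"
  obtain W where W: "\<And>i. openin Cantor (W 0 i)"
      "\<And>j i x. x \<in> W (Suc j) i \<longleftrightarrow> (\<exists>l. x \<notin> W j (prod_encode (i, l)))" "W K = (\<lambda>_. A)"
    using bSigma_code[of "\<lambda>_. A" K] A by blast
  \<comment> \<open>The open set \<open>W 0 i\<close> is observed once the cylinder of the first
    \<open>s\<close> bits lies inside it.\<close>
  define B where "B x s i \<longleftrightarrow> {y. \<forall>j<s. y j = x j} \<subseteq> W 0 i" for x :: "nat \<Rightarrow> bool" and s i
  have persistent: "B x t i" if "s \<le> t" "B x s i" for x s t i
    using that unfolding B_def by force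
  have local: "B x s = B y s" if "\<And>i. i < s \<Longrightarrow> x i = y i" for x y s
    using that by (auto simp: B_def fun_eq_iff)
  obtain f where f: "\<And>x s. good_at (B x) (\<lambda>r. f (map x [0..<r])) s"
    using good_at_uniform[of B] persistent local by blast
  \<comment> \<open>The stage exceeds every entry of the atom, so its tuple has all these
    positions.\<close>
  define q where "q x a = f (map x [0..<Suc (sum_list (snd a))])" for x and a :: "nat \<times> nat list"
  define G where "G x a = (if a \<in> atoms \<tau> then S (fst (q x a)) (fst a, map (env 0 (snd (q x a))) (snd a)) else undefined)"
    for x a
  have G_top: "G x \<in> topspace (ModSpace \<tau>)" for x
    by (auto simp: topspace_ModSpace G_def PiE_iff extensional_def)
  have "continuous_map Cantor (ModSpace \<tau>) G"
  proof (rule continuous_Cantor_ModSpace[OF G_top])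
    fix x a assume "a \<in> atoms \<tau>"
    have "G y a = G x a" if y: "\<forall>i<Suc (sum_list (snd a)). y i = x i" for y
    proof -
      have "map y [0..<Suc (sum_list (snd a))] = map x [0..<Suc (sum_list (snd a))]"
        using y by (intro map_cong) auto
      then have "q y a = q x a" unfolding q_def by (rule arg_cong)
      then show ?thesis by (simp add: G_def)
    qed
    then show "\<exists>s. \<forall>y. (\<forall>i<s. y i = x i) \<longrightarrow> G y a = G x a" by blast
  qed
  moreover have "x \<in> A \<longleftrightarrow> G x \<in> Mod \<tau> T" for x
  proof -
    have "x \<in> W 0 i \<longleftrightarrow> (\<exists>s. B x s i)" for i
    proof
      assume x: "x \<in> W 0 i"
      show "\<exists>s. B x s i"
        using bspec[OF W(1)[unfolded openin_Cantor] x] by (simp only: B_def subset_iff mem_Collect_eq)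
    qed (auto simp: B_def)
    \<comment> \<open>The truth values are \<open>\<lambda>k i. x \<in> W k i\<close>; since
      \<open>W K\<close> is constantly \<open>A\<close>, index \<open>0\<close> represents
      membership in \<open>A\<close>.\<close>
    then have "x \<in> W K 0 \<longleftrightarrow> (\<exists>s\<in>true_stages (B x) K. fact_at (B x) K s 0)"
      by (rule fact_at_true_stage) (rule W(2))
    then have \<beta>: "x \<in> A \<longleftrightarrow> (\<exists>s\<in>true_stages (B x) K. fact_at (B x) K s 0)"
      by (simp add: W(3))
    have "\<exists>h. bij h \<and> (\<forall>R as s. (R, as) \<in> atoms \<tau> \<longrightarrow> set as \<subseteq> {..<s} \<longrightarrow>
        S (fst (f (map x [0..<s]))) (R, map (env 0 (snd (f (map x [0..<s])))) as) = S (x \<in> A) (R, map h as))"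
      by (rule good_at_limit[OF _ f \<beta>]) (rule persistent)
    then obtain h where h: "bij h" "\<And>R as s. (R, as) \<in> atoms \<tau> \<Longrightarrow> set as \<subseteq> {..<s} \<Longrightarrow>
        S (fst (f (map x [0..<s]))) (R, map (env 0 (snd (f (map x [0..<s])))) as) = S (x \<in> A) (R, map h as)"
      by blast
    have iso: "G x (R, as) = S (x \<in> A) (R, map h as)" if "(R, as) \<in> atoms \<tau>" for R as
    proof -
      have "set as \<subseteq> {..<Suc (sum_list as)}"
        using member_le_sum_list[of _ as] by (auto simp: less_Suc_eq_le)
      then show ?thesis
        using h(2)[OF that] that by (simp only: G_def q_def fst_conv snd_conv if_True)
    qed
    have "G x \<in> Mod \<tau> T \<longleftrightarrow> S (x \<in> A) \<in> Mod \<tau> T"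
    proof -
      have "(\<forall>e. sat (G x) e p) \<longleftrightarrow> (\<forall>e. sat (S (x \<in> A)) e p)" if p: "p \<in> T" for p
      proof -
        have p': "wf_fm \<tau> p" "fv p = {}" using T p by (auto simp: sentence_def)
        have "sat (G x) e p = sat (S (x \<in> A)) (h \<circ> e) p" for e
          by (rule sat_iso[OF h(1) _ p'(1)]) (rule iso)
        then have "sat (G x) e p = sat (S (x \<in> A)) e' p" for e e'
          using sat_sentence[OF p'(2), of _ _ e'] by simp
        then show ?thesis by blast
      qed
      moreover have "S b \<in> topspace (ModSpace \<tau>)" for b
        using S by (cases b) (auto simp: Mod_def)
      ultimately show ?thesis
        using G_top by (simp add: Mod_def)
    qed
    then show ?thesis
      using S by (cases "x \<in> A") auto
  qed
  ultimately show "\<exists>f. continuous_map Cantor (ModSpace \<tau>) f \<and> (\<forall>x\<in>topspace Cantor. x \<in> A \<longleftrightarrow> f x \<in> Mod \<tau> T)"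
    by blast
qed

end

section \<open>From failure of axiomatizability to hardness\<close>

lemma not_univ_axiomatization_imp_hard:
  assumes T: "\<forall>p\<in>T. sentence \<tau> p" and no_ax: "\<not> has_univ_axiomatization \<tau> T (Suc K)"
  shows "hard (bSigma Cantor (Suc K)) (ModSpace \<tau>) (Mod \<tau> T)"
proof -
  define Q where "Q = {p. sentence \<tau> p \<and> univ_n (Suc K) p}"
  define e\<^sub>0 where "e\<^sub>0 = (\<lambda>_::nat. 0::nat)"
  have sat_e\<^sub>0: "(\<forall>e. sat M e p) \<longleftrightarrow> sat M e\<^sub>0 p" if "sentence \<tau> p" for M p
    using that sat_sentence unfolding sentence_def by blast
  define Ax where "Ax = {p \<in> Q. \<forall>N\<in>Mod \<tau> T. sat N e\<^sub>0 p}"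
  have "Mod \<tau> T \<subseteq> Mod \<tau> Ax"
    using sat_e\<^sub>0 unfolding Ax_def Q_def Mod_def by blast
  moreover have "\<forall>p\<in>Ax. sentence \<tau> p \<and> univ_n (Suc K) p"
    by (simp add: Ax_def Q_def)
  then have "Mod \<tau> Ax \<noteq> Mod \<tau> T"
    using no_ax unfolding has_univ_axiomatization_def by blast
  ultimately obtain M where M: "M \<in> Mod \<tau> Ax" "M \<notin> Mod \<tau> T"
    by blast
  define Fs where "Fs = {p \<in> Q. \<not> sat M e\<^sub>0 p}"
  \<comment> \<open>An unsatisfiable sentence keeps \<open>Fs\<close> nonempty, so that all values
    of \<open>from_nat_into Fs\<close> lie in \<open>Fs\<close>.\<close>
  have "univ_n (Suc K) (All 0 (Neg (Eq 0 0)))"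
    by (rule univ_n_exi_n.intros(3)[OF qfree_univ_n]) simp
  then have "All 0 (Neg (Eq 0 0)) \<in> Fs"
    by (simp add: Fs_def Q_def sentence_def)
  then have Fs_ne: "Fs \<noteq> {}" by blast
  \<comment> \<open>Otherwise the disjunction of these finitely many sentences would belong to
    \<open>Ax\<close> up to equivalence, and so hold in \<open>M\<close>, where each disjunct
    fails.\<close>
  have "\<exists>N\<in>Mod \<tau> T. \<forall>j\<le>i. \<not> sat N e\<^sub>0 (from_nat_into Fs j)" for i
  proof (rule ccontr)
    assume contra: "\<not> (\<exists>N\<in>Mod \<tau> T. \<forall>j\<le>i. \<not> sat N e\<^sub>0 (from_nat_into Fs j))"
    let ?ps = "map (from_nat_into Fs) [0..<Suc i]"
    have ps: "p \<in> Fs" if "p \<in> set ?ps" for p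
      using that from_nat_into[OF Fs_ne] by auto
    have "\<forall>p\<in>set ?ps. univ_n (Suc K) p \<and> wf_fm \<tau> p \<and> fv p \<subseteq> {}"
      using ps unfolding Fs_def Q_def sentence_def by blast
    then obtain r where r: "univ_n (Suc K) r" "wf_fm \<tau> r" "fv r \<subseteq> {}" "\<forall>M e. sat M e r = (\<exists>p\<in>set ?ps. sat M e p)"
      using prenex_junct_list[of ?ps "Suc K" \<tau> "{}" False] by auto
    have "sat N e\<^sub>0 r" if "N \<in> Mod \<tau> T" for N
    proof -
      obtain j where "j \<le> i" "sat N e\<^sub>0 (from_nat_into Fs j)"
        using contra \<open>N \<in> Mod \<tau> T\<close> by blast
      moreover from this have "from_nat_into Fs j \<in> set ?ps"
        unfolding set_map set_upt by (intro imageI) simp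
      ultimately show ?thesis
        using r(4) by blast
    qed
    then have "r \<in> Ax"
      using r by (simp add: Ax_def Q_def sentence_def)
    then have "sat M e\<^sub>0 r"
      using M(1) unfolding Mod_def by blast
    then show False
      using r(4) ps unfolding Fs_def by blast
  qed
  then obtain N where N: "\<And>i. N i \<in> Mod \<tau> T" "\<And>i j. j \<le> i \<Longrightarrow> \<not> sat (N i) e\<^sub>0 (from_nat_into Fs j)"
    by metis
  obtain F where "free_ultrafilter F"
    using free_ultrafilter_exists by blast
  then interpret free_ultrafilter F .
  \<comment> \<open>The two families are the sequence \<open>N\<close> and the constant sequence
    \<open>M\<close>, giving an ultraproduct and an ultrapower.\<close>
  obtain S where S: "\<And>b. S b \<in> topspace (ModSpace \<tau>)"
      "\<And>b p. sentence \<tau> p \<Longrightarrow> sat (S b) e\<^sub>0 p \<longleftrightarrow> eventually (\<lambda>n. sat (if b then N n else M) e\<^sub>0 p) F"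
      "\<And>b b' k l l'. type_le \<tau> (Suc k) (S b) l (S b') l' \<Longrightarrow>
           \<exists>m. length (l @ m) = length l' \<and> type_le \<tau> k (S b') l' (S b) (l @ m)"
    using countable_saturated_family[of \<tau> e\<^sub>0 "\<lambda>b n. if b then N n else M"] by blast
  have S_False: "sat (S False) e\<^sub>0 p \<longleftrightarrow> sat M e\<^sub>0 p" if "sentence \<tau> p" for p
    using S(2)[OF that, of False] nontrivial by simp
  \<comment> \<open>A sentence with number \<open>j\<close> in \<open>Fs\<close> fails in
    \<open>N n\<close> for all \<open>n \<ge> j\<close>, hence almost everywhere, hence in
    \<open>S True\<close>.\<close>
  have "sat (S False) e\<^sub>0 p" if p: "p \<in> Q" and true: "sat (S True) e\<^sub>0 p" for p
  proof (rule ccontr)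
    assume "\<not> sat (S False) e\<^sub>0 p"
    then have "p \<in> Fs"
      using p S_False by (simp add: Fs_def Q_def)
    then obtain j where j: "p = from_nat_into Fs j"
      using from_nat_into_surj[of Fs p] by auto
    have "eventually (\<lambda>n. \<not> sat (N n) e\<^sub>0 p) F"
      using eventually_ge[of j] by (rule eventually_mono) (use N(2) j in blast)
    then show False
      using true p S(2)[of p True] by (simp add: Q_def eventually_not_iff)
  qed
  moreover have "env 0 [] = e\<^sub>0"
    by (simp add: env_def e\<^sub>0_def fun_eq_iff)
  ultimately have "type_le \<tau> (Suc K) (S True) [] (S False) []"
    by (simp add: type_le_def Q_def sentence_def)
  then interpret back_and_forth_pair \<tau> S K
    by unfold_locales (rule S(3))
  have "sat (S True) e\<^sub>0 p" if "p \<in> T" for p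
    using that T N(1) S(2)[of p True] unfolding Mod_def by simp
  then have "S True \<in> Mod \<tau> T"
    using S(1) T sat_e\<^sub>0 unfolding Mod_def by blast
  moreover have "S False \<notin> Mod \<tau> T"
    using M T S_False sat_e\<^sub>0 unfolding Mod_def by blast
  ultimately show ?thesis
    using hard_Mod[OF T] S(1) by blast
qed

theorem theorem4p18:
  fixes \<tau> :: vocab and T :: "fm set" and n :: nat
  assumes "\<forall>p\<in>T. sentence \<tau> p"
    and "n \<ge> 2"
  shows "(has_univ_axiomatization \<tau> T n \<and> \<not> has_univ_axiomatization \<tau> T (n - 1))
     \<longleftrightarrow> (Mod \<tau> T \<in> bPi (ModSpace \<tau>) n \<and> hard (bSigma Cantor (n - 1)) (ModSpace \<tau>) (Mod \<tau> T))"
proof -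
  obtain k where n: "n = Suc (Suc k)"
    using assms(2) by (metis One_nat_def Suc_1 Suc_le_D Suc_le_mono)
  have "has_univ_axiomatization \<tau> T (Suc m) \<longleftrightarrow> Mod \<tau> T \<in> bPi (ModSpace \<tau>) (Suc m)"
      "has_univ_axiomatization \<tau> T (Suc m) \<longleftrightarrow> \<not> hard (bSigma Cantor (Suc m)) (ModSpace \<tau>) (Mod \<tau> T)" for m
    using has_univ_axiomatization_imp_bPi not_univ_axiomatization_imp_hard[OF assms(1)]
      hard_bSigma_imp_notin_bPi by blast+
  from this(1)[of "Suc k"] this(2)[of k] show ?thesis
    unfolding n diff_Suc_1 by blast
qed

end
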